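(* Let $n$ be a positive integer, let $g$ be a polynomial on $\mathbb{C}^n$, and suppose that $u=u(z)=u(z_1,\dots,z_n)$ is an entire function on $\mathbb{C}^n$ satisfying $$u_{z_1}u_{z_2}\cdots u_{z_n}=e^{g}.$$ Let $I=\{1,\dots,n\}$, and let $J\subseteq I$, $\sharp J$, $\chi=I\setminus J$ and the relation $\approx$ be as defined in the context (for this $u$). Then the following holds, according to the value of $\sharp J$. (a) If $\sharp J=n$, then there are entire functions $g_1,\dots,g_n$ of one complex variable and an integer $k_0$ such that $$g(z)=\sum_{j=1}^n g_j(z_j)+2k_0\pi \sqrt{-1},\qquad u(z)=\sum_{j=1}^n\int e^{g_j(z_j)}\,dz_j .$$ (b) If $\sharp J=0$, then there exists a partition $I=\bigcup_{l=1}^t I_l$ with $I_l=\{k_{l1},\dots,k_{l\theta_l}\}$ and $\sharp I_l=\theta_l=m_l\ge 2$, such that for any $i\in I_\mu$ and $j\in I_\lambda$ with $1\le \mu,\lambda\le t$, $$u_{z_i}\approx u_{z_j}\ \text{ if } \mu=\lambda,\qquad u_{z_i}\not\approx u_{z_j}\ \text{ if } \mu\neq\lambda .$$ In addition, there are entire functions $g_l$ and $f_l$ of one complex variable with $f_l'=e^{g_l/m_l}$ $(1\le l\le t)$, complex constants $A_{lj}$ $(1\le l\le t,\ 1\le j\le \theta_l)$ and an integer $k_0$ such that $$g(z)=\sum_{l=1}^t g_l\left(A_{l1}z_{k_{l1}}+\cdots+A_{l\theta_l}z_{k_{l\theta_l}}\right)+2k_0\pi \sqrt{-1},$$ $$u(z)=\sum_{l=1}^t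 f_l\left(A_{l1}z_{k_{l1}}+\cdots+A_{l\theta_l}z_{k_{l\theta_l}}\right).$$ (c) If $0<\sharp J<n$ and $J=\{\tau_1,\dots,\tau_\nu\}$ with $\nu=\sharp J$, then there exists a partition $\chi=I\setminus J=\bigcup_{l=1}^t I_l$ with $I_l=\{k_{l1},\dots,k_{l\theta_l}\}$ and $\sharp I_l=\theta_l=m_l\ge 2$, such that for any $i\in I_\mu$ and $j\in I_\lambda$ with $1\le\mu,\lambda\le t$, $u_{z_i}\approx u_{z_j}$ if $\mu=\lambda$ and $u_{z_i}\not\approx u_{z_j}$ if $\mu\ne\lambda$; and there are entire functions $g_1,\dots,g_\nu$, $h_1,\dots,h_t$ and $f_1,\dots,f_t$ of one complex variable with $f_l'=e^{h_l/m_l}$ $(1\le l\le t)$, complex constants $A_{lj}$ $(1\le l\le t,\ 1\le j\le\theta_l)$ and an integer $k_0$ such that $$g(z)=\sum_{i=1}^\nu g_i(z_{\tau_i})+\sum_{l=1}^t h_l\left(A_{l1}z_{k_{l1}}+\cdots+A_{l\theta_l}z_{k_{l\theta_l}}\right)+2k_0\pi \sqrt{-1},$$ $$u(z)=\sum_{i=1}^\nu\int e^{g_i(z_{\tau_i})}\,dz_{\tau_i}+\sum_{l=1}^t f_l\left(A_{l1}z_{k_{l1}}+\cdots+A_{l\theta_l}z_{k_{l\theta_l}}\right).$$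
   Context: An entire function on $\mathbb{C}^n$ is a holomorphic function $\mathbb{C}^n\to\mathbb{C}$; $u_{z_i}=\partial u/\partial z_i$ and $u_{ij}=u_{z_iz_j}$ for $i,j\in I=\{1,2,\dots,n\}$. For a finite set $G$, $\sharp G$ is its number of elements. Given $u$, set $$J=\{i\in I:\ u_{ij}\equiv 0\ \text{for every } j\in I\setminus\{i\}\},\qquad \chi=I\setminus J$$ ($J$ may be empty). Write $u_{z_i}\sim u_{z_j}$ if $u_{ij}\not\equiv 0$ (a symmetric relation, since $u_{ij}=u_{ji}$). Write $u_{z_i}\approx u_{z_j}$ if $u_{z_i}\sim u_{z_j}$ or there is a finite chain $u_{z_i}\sim u_{z_k}\sim\cdots\sim u_{z_j}$; otherwise write $u_{z_i}\not\approx u_{z_j}$. These relations are understood as relations between the indices $i$ and $j$. The notation $\int e^{g_j(z_j)}\,dz_j$ means some entire antiderivative, in the single variable $z_j$, of $e^{g_j(z_j)}$ (the constant of integration being chosen suitably). *)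

theory Defs
  imports "HOL-Complex_Analysis.Complex_Analysis"
begin

text \<open>
  Points of complex \<open>n\<close>-space are vectors of type \<^typ>\<open>complex ^ 'n\<close>; the index set \<open>{1,\<dots>,n}\<close>
  is the finite type \<open>'n\<close>.
\<close>

text \<open>
  \<open>has_derivative\<close> on \<^typ>\<open>complex ^ 'n\<close> only asks for a real-linear derivative, so
  complex linearity is demanded separately.
\<close>

definition entire_fun :: "(complex ^ 'n \<Rightarrow> complex) \<Rightarrow> bool" where
  "entire_fun u \<longleftrightarrow>
     (\<forall>z. \<exists>D. (u has_derivative D) (at z) \<and> (\<forall>c v. D (c *s v) = c * D v))"

definition polynomial_fun :: "(complex ^ 'n \<Rightarrow> complex) \<Rightarrow> bool" where
  "polynomial_fun g \<longleftrightarrow>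
     (\<exists>(S :: ('n \<Rightarrow> nat) set) c. finite S \<and>
        (\<forall>z. g z = (\<Sum>\<alpha>\<in>S. c \<alpha> * (\<Prod>i\<in>UNIV. (z $ i) ^ \<alpha> i))))"

definition partial_deriv :: "'n \<Rightarrow> (complex ^ 'n \<Rightarrow> complex) \<Rightarrow> complex ^ 'n \<Rightarrow> complex" where
  "partial_deriv i u z = deriv (\<lambda>w. u (\<chi> k. if k = i then w else z $ k)) (z $ i)"

definition partial_deriv2 ::
    "'n \<Rightarrow> 'n \<Rightarrow> (complex ^ 'n \<Rightarrow> complex) \<Rightarrow> complex ^ 'n \<Rightarrow> complex" where
  "partial_deriv2 i j u = partial_deriv j (partial_deriv i u)"

definition J_set :: "(complex ^ 'n \<Rightarrow> complex) \<Rightarrow> 'n set" where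
  "J_set u = {i. \<forall>j. j \<noteq> i \<longrightarrow> (\<forall>z. partial_deriv2 i j u z = 0)}"

definition linked :: "(complex ^ 'n \<Rightarrow> complex) \<Rightarrow> 'n \<Rightarrow> 'n \<Rightarrow> bool" where
  "linked u i j \<longleftrightarrow> (\<exists>z. partial_deriv2 i j u z \<noteq> 0)"

text \<open>
  The transitive, not the reflexive transitive, closure: an index is related to itself only
  through an actual chain.
\<close>

definition chained :: "(complex ^ 'n \<Rightarrow> complex) \<Rightarrow> 'n \<Rightarrow> 'n \<Rightarrow> bool" where
  "chained u = tranclp (linked u)"

text \<open>
  \<open>chain_partition u X t P \<theta> k\<close>: the set \<open>X\<close> is partitioned into blocks
  \<open>P l = {k l 1, \<dots>, k l (\<theta> l)}\<close> for \<open>1 \<le> l \<le> t\<close>, with \<open>\<theta> l \<ge> 2\<close> distinct elements each, and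
  two elements of \<open>X\<close> are chained exactly if they lie in the same block.
\<close>

definition chain_partition ::
    "(complex ^ 'n \<Rightarrow> complex) \<Rightarrow> 'n set \<Rightarrow> nat \<Rightarrow> (nat \<Rightarrow> 'n set) \<Rightarrow> (nat \<Rightarrow> nat)
      \<Rightarrow> (nat \<Rightarrow> nat \<Rightarrow> 'n) \<Rightarrow> bool" where
  "chain_partition u X t P \<theta> k \<longleftrightarrow>
     X = (\<Union>l\<in>{1..t}. P l) \<and>
     disjoint_family_on P {1..t} \<and>
     (\<forall>l\<in>{1..t}. P l = k l ` {1..\<theta> l} \<and> card (P l) = \<theta> l \<and> \<theta> l \<ge> 2) \<and>
     (\<forall>\<mu>\<in>{1..t}. \<forall>\<nu>\<in>{1..t}. \<forall>i\<in>P \<mu>. \<forall>j\<in>P \<nu>.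
        (\<mu> = \<nu> \<longrightarrow> chained u i j) \<and> (\<mu> \<noteq> \<nu> \<longrightarrow> \<not> chained u i j))"

definition entire_antiderivative :: "(complex \<Rightarrow> complex) \<Rightarrow> (complex \<Rightarrow> complex) \<Rightarrow> bool" where
  "entire_antiderivative F h \<longleftrightarrow>
     F holomorphic_on UNIV \<and> (\<forall>w. (F has_field_derivative h w) (at w))"

end

theory Submission
  imports Defs "HOL-Real_Asymp.Real_Asymp"
begin

text \<open>
  Write \<open>u\<^sub>i\<close> for the partial derivatives of \<open>u\<close>. Their product never vanishes, so each of them is
  \<open>exp h\<^sub>i\<close> with \<open>h\<^sub>i\<close> entire, and the sum of all \<open>h\<^sub>i\<close> is \<open>g\<close> up to a multiple of \<open>2 \<pi> i\<close>. The chain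
  relation splits the indices into blocks. As \<open>u\<^sub>i\<^sub>j = 0\<close> for \<open>i\<close> and \<open>j\<close> in different blocks, \<open>h\<^sub>i\<close>
  involves only the variables of its own block; setting the other variables to \<open>0\<close> shows that the sum
  of the \<open>h\<^sub>i\<close> over one block is of polynomial growth.

  The heart of the matter is that \<open>h\<^sub>i - h\<^sub>j\<close> is constant whenever \<open>i\<close> and \<open>j\<close> are linked. Comparing
  \<open>u\<^sub>i\<^sub>j\<close> with \<open>u\<^sub>j\<^sub>i\<close> gives

    \<open>exp (h\<^sub>i - h\<^sub>j) = (\<partial>\<^sub>i h\<^sub>j) / (\<partial>\<^sub>j h\<^sub>i)\<close>,

  an exponential on the left against derivatives of the exponents on the right. In Nevanlinna's
  theory the characteristic of a non-constant left-hand side is far larger than that of \<open>h\<^sub>i - h\<^sub>j\<close>, while the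
  right-hand side is controlled by the \<open>h\<^sub>i\<close>, which in turn are controlled by a polynomial and by the
  differences inside the block. The argument is carried out here in elementary terms. The
  one-variable lemma \<open>exponent_of_quotient_bound\<close>, proved by Jensen's inequality and the Schwarz formula,
  bounds \<open>p\<close> linearly by the logarithms of the bounds for \<open>D\<close> and \<open>exp p D\<close>. Applied on the complex
  lines through a common non-zero of the denominators, and with Borel's growth lemma
  (\<open>Borel_growth\<close>) to compare the growth at two nearby radii, it makes the differences \<open>O((ln r)\<^sup>2)\<close> on an
  unbounded set of radii, hence constant by Liouville's theorem
  (\<open>linked_logarithms_differ_by_constants\<close>).

  Consequently, on a block \<open>B\<close> with \<open>m\<close> elements, \<open>u\<^sub>j = A\<^sub>j exp (g\<^sub>B / m)\<close> where \<open>g\<^sub>B\<close> is the sum of the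
  logarithms and the \<open>A\<^sub>j\<close> are non-zero constants. The part of the gradient that belongs to \<open>B\<close> thus has
  constant direction, so \<open>g\<^sub>B\<close> is a function of the linear form \<open>\<Sum>\<^sub>j A\<^sub>j z\<^sub>j\<close> over \<open>B\<close>
  (\<open>block_exponent_eq\<close>), and integration along lines gives the representation of \<open>u\<close>
  (\<open>u_representation\<close>). An index of \<open>J_set u\<close> is a block with one element, whose linear form is the
  coordinate.
\<close>

section \<open>Functions holomorphic on complex lines\<close>

text \<open>
  Holomorphy in several variables enters only through restrictions to complex lines. Together with
  continuity this is a class of functions that is closed under directional derivatives, and every
  one-variable theorem can be applied to its members directly.
\<close>

definition line_holomorphic :: "(complex ^ 'n \<Rightarrow> complex) \<Rightarrow> bool" where
  "line_holomorphic f \<longleftrightarrow>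
     continuous_on UNIV f \<and> (\<forall>z v. (\<lambda>t. f (z + t *s v)) holomorphic_on UNIV)"

definition ddir :: "complex ^ 'n \<Rightarrow> (complex ^ 'n \<Rightarrow> complex) \<Rightarrow> complex ^ 'n \<Rightarrow> complex" where
  "ddir v f z = deriv (\<lambda>t. f (z + t *s v)) 0"

lemma norm_vector_smult: "norm (c *s (v :: complex ^ 'n)) = norm c * norm v"
  by (simp add: norm_vec_def norm_mult L2_set_right_distrib)

lemma continuous_on_vector_smult [continuous_intros]:
  fixes v :: "'a::topological_space \<Rightarrow> complex ^ 'n"
  assumes "continuous_on S c" "continuous_on S v"
  shows "continuous_on S (\<lambda>x. c x *s v x)"
  unfolding vector_scalar_mult_def
  using assms by (intro continuous_intros)

lemma line_holomorphic_continuous: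
  assumes "line_holomorphic f" "continuous_on S p"
  shows "continuous_on S (\<lambda>x. f (p x))"
  using assms continuous_on_compose2[of UNIV f S p] by (auto simp: line_holomorphic_def)

lemma has_field_derivative_ddir:
  assumes "line_holomorphic f"
  shows "((\<lambda>t. f (z + t *s v)) has_field_derivative ddir v f (z + t *s v)) (at t within S)"
proof -
  have "((\<lambda>s. f ((z + t *s v) + s *s v)) has_field_derivative ddir v f (z + t *s v)) (at 0)"
    unfolding ddir_def using assms
    by (auto simp: line_holomorphic_def intro!: holomorphic_derivI[of _ UNIV])
  moreover have "(\<lambda>s. f ((z + t *s v) + s *s v)) = (\<lambda>s. f (z + (t + s) *s v))"
    by (simp add: vector_sadd_rdistrib add.assoc)
  ultimately have "((\<lambda>s. f (z + s *s v)) has_field_derivative ddir v f (z + t *s v)) (at t)"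
    using DERIV_shift[of "\<lambda>s. f (z + s *s v)" _ 0 t] by (simp add: add.commute)
  thus ?thesis by (rule has_field_derivative_at_within)
qed

text \<open>
  Integrals over the unit circle are written as integrals over \<open>{0..1}\<close> against the uniform
  probability measure, so that Cauchy's formulas become mean values without a factor \<open>2 \<pi> i\<close>.
\<close>

definition circ :: "real \<Rightarrow> complex" where "circ x = exp (2 * of_real pi * \<i> * of_real x)"

lemma continuous_on_circ [continuous_intros]:
  "continuous_on S p \<Longrightarrow> continuous_on S (\<lambda>x. circ (p x))"
  unfolding circ_def by (intro continuous_intros)

lemma norm_circ [simp]: "norm (circ x) = 1"
  by (simp add: circ_def norm_exp_eq_Re)

lemma circ_neq_0 [simp]: "circ x \<noteq> 0"
  by (simp add: circ_def)

lemma Cauchy_formula_circ: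
  assumes "f holomorphic_on UNIV" "norm w < 1"
  shows "((\<lambda>x. f (circ x) * circ x / (circ x - w)) has_integral f w) {0..1}"
proof -
  have "((\<lambda>u. f u / (u - w)) has_contour_integral (2 * of_real pi * \<i> * f w)) (circlepath 0 1)"
    using assms by (intro Cauchy_integral_circlepath_simple) (auto intro: holomorphic_on_subset)
  hence "((\<lambda>x. f (circ x) / (circ x - w) * (2 * of_real pi * \<i> * circ x))
            has_integral (2 * of_real pi * \<i> * f w)) {0..1}"
    unfolding has_contour_integral vector_derivative_circlepath by (simp add: circlepath circ_def)
  from has_integral_mult_right[OF this, of "1 / (2 * of_real pi * \<i>)"] show ?thesis
    by (simp add: field_simps)
qed

text \<open>
  Cauchy's formula for the derivative. Writing the derivative as an integral of values of \<open>f\<close>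
  transfers continuity and holomorphy in the remaining directions from \<open>f\<close> to its derivative.
\<close>

lemma ddir_integral:
  assumes "line_holomorphic f"
  shows "((\<lambda>x. f (z + circ x *s v) / circ x) has_integral ddir v f z) {0..1}"
proof -
  let ?\<phi> = "\<lambda>t. f (z + t *s v)"
  have hol: "?\<phi> holomorphic_on UNIV" using assms by (auto simp: line_holomorphic_def)
  have "((\<lambda>u. ?\<phi> u / (u - 0) ^ (Suc 1)) has_contour_integral
          (of_real (2 * pi) * \<i> / fact 1 * (deriv ^^ 1) ?\<phi> 0)) (circlepath 0 1)"
    using hol by (intro Cauchy_has_contour_integral_higher_derivative_circlepath)
                 (auto intro: holomorphic_on_subset holomorphic_on_imp_continuous_on)
  hence "((\<lambda>x. ?\<phi> (circ x) / circ x ^ 2 * (2 * of_real pi * \<i> * circ x))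
            has_integral (2 * of_real pi * \<i> * ddir v f z)) {0..1}"
    unfolding has_contour_integral vector_derivative_circlepath
    by (simp add: circlepath circ_def ddir_def power2_eq_square)
  from has_integral_mult_right[OF this, of "1 / (2 * of_real pi * \<i>)"] show ?thesis
    by (simp add: field_simps power2_eq_square)
qed

lemma ddir_continuous:
  assumes "line_holomorphic f"
  shows "continuous_on UNIV (ddir v f)"
proof -
  have "continuous_on UNIV (\<lambda>z. integral (cbox 0 1) (\<lambda>x. f (z + circ x *s v) / circ x))"
    by (intro integral_continuous_on_param)
       (auto simp: case_prod_unfold intro!: continuous_intros line_holomorphic_continuous[OF assms])
  moreover have "(\<lambda>z. integral (cbox 0 1) (\<lambda>x. f (z + circ x *s v) / circ x)) = ddir v f"
    using ddir_integral[OF assms] by (auto simp: integral_unique)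
  ultimately show ?thesis by (simp only:)
qed

text \<open>
  Differentiation under the integral sign in \<open>ddir_integral\<close>. The resulting formula gives at once
  that derivatives stay in the class and that two of them commute.
\<close>

lemma ddir_ddir_derivative:
  assumes "line_holomorphic f"
  shows "((\<lambda>t. ddir v f (z + t *s w)) has_field_derivative
           integral {0..1} (\<lambda>x. ddir w f (z + t *s w + circ x *s v) / circ x)) (at t)"
proof -
  have "((\<lambda>t. integral (cbox 0 1) (\<lambda>x. f (z + circ x *s v + t *s w) / circ x)) has_field_derivative
           integral (cbox 0 1) (\<lambda>x. ddir w f (z + circ x *s v + t *s w) / circ x)) (at t within UNIV)"
  proof (rule leibniz_rule_field_derivative)
    show "((\<lambda>t. f (z + circ x *s v + t *s w) / circ x) has_field_derivative
             ddir w f (z + circ x *s v + t *s w) / circ x) (at t within UNIV)" for t x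
      by (intro DERIV_cdivide has_field_derivative_ddir[OF assms])
    show "(\<lambda>x. f (z + circ x *s v + t *s w) / circ x) integrable_on cbox 0 1" for t
      by (intro integrable_continuous) (auto intro!: continuous_intros line_holomorphic_continuous[OF assms])
    show "continuous_on (UNIV \<times> cbox 0 1) (\<lambda>(t, x). ddir w f (z + circ x *s v + t *s w) / circ x)"
      by (auto simp: case_prod_unfold intro!: continuous_intros
            continuous_on_compose2[OF ddir_continuous[OF assms]])
  qed auto
  moreover have "integral (cbox 0 1) (\<lambda>x. f (z + circ x *s v + t *s w) / circ x) = ddir v f (z + t *s w)" for t
    using ddir_integral[OF assms, of "z + t *s w" v] by (simp add: integral_unique add_ac)
  ultimately show ?thesis by (simp add: add_ac)
qed

lemma ddir_line_holomorphic:
  assumes "line_holomorphic f"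
  shows "line_holomorphic (ddir v f)"
  unfolding line_holomorphic_def
proof (intro conjI allI)
  show "continuous_on UNIV (ddir v f)" by (rule ddir_continuous[OF assms])
  fix z w :: "complex ^ 'a"
  show "(\<lambda>t. ddir v f (z + t *s w)) holomorphic_on UNIV"
    using ddir_ddir_derivative[OF assms, of v z w]
    by (auto simp: holomorphic_on_def intro!: exI field_differentiable_at_within simp: field_differentiable_def)
qed

lemma ddir_commute:
  assumes "line_holomorphic f"
  shows "ddir w (ddir v f) z = ddir v (ddir w f) z"
proof -
  have "ddir w (ddir v f) z = integral {0..1} (\<lambda>x. ddir w f (z + circ x *s v) / circ x)"
    using DERIV_imp_deriv[OF ddir_ddir_derivative[OF assms, of v z w 0]]
    by (simp add: ddir_def[of w "ddir v f"])
  also have "\<dots> = ddir v (ddir w f) z"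
    using ddir_integral[OF ddir_line_holomorphic[OF assms, of w], of z v] by (rule integral_unique)
  finally show ?thesis .
qed

lemma norm_ddir_le:
  assumes "line_holomorphic f" "\<rho> > 0" "\<And>t. norm t = \<rho> \<Longrightarrow> norm (f (z + t *s v)) \<le> B"
  shows "norm (ddir v f z) \<le> B / \<rho>"
proof -
  have hol: "(\<lambda>t. f (z + t *s v)) holomorphic_on UNIV" using assms by (auto simp: line_holomorphic_def)
  have "norm ((deriv ^^ 1) (\<lambda>t. f (z + t *s v)) 0) \<le> fact 1 * B / \<rho> ^ 1"
    using assms hol by (intro Cauchy_inequality)
      (auto intro: holomorphic_on_subset holomorphic_on_imp_continuous_on)
  thus ?thesis by (simp add: ddir_def)
qed

lemma constant_if_ddir_zero:
  assumes "line_holomorphic f" "\<And>z. ddir v f z = 0"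
  shows "f (z + v) = f z"
proof -
  have "((\<lambda>t. f (z + t *s v)) has_field_derivative 0) (at t within UNIV)" for t
    using has_field_derivative_ddir[OF assms(1), of z v t UNIV] assms(2) by simp
  then obtain c where "\<And>t. f (z + t *s v) = c"
    using has_field_derivative_zero_constant[of UNIV "\<lambda>t. f (z + t *s v)"] by auto
  from this[of 0] this[of 1] show ?thesis by simp
qed

lemma line_holomorphic_diff:
  "line_holomorphic f \<Longrightarrow> line_holomorphic g \<Longrightarrow> line_holomorphic (\<lambda>z. f z - g z)"
  by (auto simp: line_holomorphic_def intro!: continuous_intros holomorphic_intros)

text \<open>
  The difference of the two logarithms is continuous and takes values in the discrete set
  \<open>2 \<pi> i \<int>\<close>.
\<close>

lemma continuous_logarithms_differ_by_constant:
  fixes h k :: "'a::real_normed_vector \<Rightarrow> complex"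
  assumes "continuous_on UNIV h" "continuous_on UNIV k" "\<And>z. exp (h z) = exp (k z)"
  shows "\<exists>n::int. \<forall>z. h z = k z + 2 * of_int n * of_real pi * \<i>"
proof -
  have ex: "\<exists>n::int. h z - k z = 2 * of_int n * of_real pi * \<i>" for z
    using assms(3)[of z] by (auto simp: exp_eq algebra_simps)
  have "(\<lambda>z. h z - k z) constant_on UNIV"
  proof (rule continuous_discrete_range_constant)
    fix x
    show "\<exists>e>0. \<forall>y. y \<in> UNIV \<and> h y - k y \<noteq> h x - k x \<longrightarrow> e \<le> norm ((h y - k y) - (h x - k x))"
    proof (intro exI[of _ 1] conjI allI impI)
      fix y assume y: "y \<in> UNIV \<and> h y - k y \<noteq> h x - k x"
      obtain m n :: int where mn: "h x - k x = 2 * of_int m * of_real pi * \<i>"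
        "h y - k y = 2 * of_int n * of_real pi * \<i>" using ex by metis
      have "(h y - k y) - (h x - k x) = of_int (n - m) * (of_real (2 * pi) * \<i>)"
        unfolding mn by (simp add: algebra_simps)
      hence "norm ((h y - k y) - (h x - k x)) = real_of_int \<bar>n - m\<bar> * (2 * pi)"
        by (simp only: norm_mult norm_of_int norm_ii norm_of_real) simp
      moreover have "real_of_int \<bar>n - m\<bar> \<ge> 1" using y mn by auto
      moreover have "2 * pi \<ge> 1" using pi_ge_two by linarith
      ultimately show "1 \<le> norm ((h y - k y) - (h x - k x))"
        using mult_mono[of 1 "real_of_int \<bar>n - m\<bar>" 1 "2 * pi"] by simp
    qed simp
  qed (use assms in \<open>auto intro!: continuous_intros\<close>)
  then obtain c where "\<And>z. h z - k z = c" by (auto simp: constant_on_def)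
  thus ?thesis using ex by (metis diff_eq_eq add.commute)
qed

text \<open>
  The domain is contractible, which gives a continuous logarithm. On each complex line it differs by a
  constant from a holomorphic one, hence is holomorphic there.
\<close>

lemma line_holomorphic_logarithm:
  fixes f :: "complex ^ 'n \<Rightarrow> complex"
  assumes "line_holomorphic f" "\<And>z. f z \<noteq> 0"
  obtains h where "line_holomorphic h" "\<And>z. f z = exp (h z)"
proof -
  have contr: "contractible (UNIV :: (complex ^ 'n) set)"
    by (intro convex_imp_contractible) auto
  obtain h where h: "continuous_on UNIV h" "\<And>z. f z = exp (h z)"
    using continuous_logarithm_on_contractible[OF _ contr, of f] assms
    by (auto simp: line_holomorphic_def)
  have "(\<lambda>t. h (z + t *s v)) holomorphic_on UNIV" for z v
  proof -
    have cont: "continuous_on UNIV (\<lambda>t. h (z + t *s v))"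
      by (intro continuous_on_compose2[OF h(1)] continuous_intros) auto
    have "(\<lambda>t. f (z + t *s v)) holomorphic_on UNIV" using assms by (auto simp: line_holomorphic_def)
    then obtain k where k: "k holomorphic_on UNIV" "\<And>t. f (z + t *s v) = exp (k t)"
      using g_imp_holomorphic_log[OF _ cont] h assms by auto
    have "continuous_on UNIV k" using k(1) by (rule holomorphic_on_imp_continuous_on)
    from continuous_logarithms_differ_by_constant[OF cont this] k(2) h(2)
    obtain c where "\<And>t. h (z + t *s v) = k t + c" by metis
    thus ?thesis using k(1) by (auto intro!: holomorphic_intros)
  qed
  with h show ?thesis by (intro that[of h]) (auto simp: line_holomorphic_def)
qed

lemma ddir_exp:
  assumes "line_holomorphic h" "\<And>z. f z = exp (h z)"
  shows "ddir v f z = f z * ddir v h z"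
proof -
  have "((\<lambda>t. exp (h (z + t *s v))) has_field_derivative exp (h (z + 0 *s v)) * ddir v h (z + 0 *s v)) (at 0)"
    by (intro DERIV_fun_exp has_field_derivative_ddir[OF assms(1)])
  thus ?thesis unfolding ddir_def[of v f] by (intro DERIV_imp_deriv) (simp add: assms(2))
qed

text \<open>
  On the line that joins a non-zero of \<open>f\<close> to a non-zero of \<open>g\<close> both restrictions are
  holomorphic and not identically zero, so the identity theorem applies.
\<close>

lemma nonvanishing_point_mult:
  assumes "line_holomorphic f" "line_holomorphic g" "f a \<noteq> 0" "g b \<noteq> 0"
  shows "\<exists>z. f z * g z \<noteq> 0"
proof (rule ccontr)
  assume "\<not> ?thesis"
  hence z: "f z = 0 \<or> g z = 0" for z by auto
  let ?l = "\<lambda>t. a + t *s (b - a)"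
  have "(\<lambda>t. f (?l t)) holomorphic_on UNIV" "(\<lambda>t. g (?l t)) holomorphic_on UNIV"
    using assms unfolding line_holomorphic_def by blast+
  moreover have "f (?l 0) \<noteq> 0" "g (?l 1) \<noteq> 0" using assms by auto
  moreover have "continuous_on UNIV (\<lambda>t. g (?l t))"
    using \<open>(\<lambda>t. g (?l t)) holomorphic_on UNIV\<close> by (intro holomorphic_on_imp_continuous_on)
  ultimately obtain e where e: "e > 0" "\<And>t. dist 1 t < e \<Longrightarrow> g (?l t) \<noteq> 0"
    using continuous_on_open_avoid[of UNIV "\<lambda>t. g (?l t)" 1 0] by auto
  have "f (?l 0) = 0"
  proof (rule analytic_continuation_open[of "ball 1 e" UNIV "\<lambda>t. f (?l t)" "\<lambda>_. 0"])
    show "f (?l t) = 0" if "t \<in> ball 1 e" for t using z[of "?l t"] e(2)[of t] that by auto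
  qed (use e \<open>(\<lambda>t. f (?l t)) holomorphic_on UNIV\<close> in auto)
  with assms show False by simp
qed

section \<open>Growth of the exponent of a holomorphic quotient\<close>

lemma grid_integral_le:
  fixes F :: "real \<Rightarrow> real"
  assumes "continuous_on {0..1} F" "M > 0"
    and osc: "\<And>k x. k < M \<Longrightarrow> real k / M \<le> x \<Longrightarrow> x \<le> (real k + 1) / M \<Longrightarrow> F x \<le> F (real k / M) + \<epsilon>"
  shows "integral {0..1} F \<le> (\<Sum>k<M. F (real k / M)) / M + \<epsilon>"
proof -
  have "integral {0..real K / M} F \<le> (\<Sum>k<K. (F (real k / M) + \<epsilon>) / M)" if "K \<le> M" for K
    using that
  proof (induction K)
    case (Suc K)
    have le: "(real K + 1) / M \<le> 1" using Suc.prems \<open>M > 0\<close> by (simp add: field_simps)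
    have int: "F integrable_on {a..b}" if "0 \<le> a" "b \<le> 1" for a b
      using that assms(1) by (intro integrable_continuous_real) (auto intro: continuous_on_subset)
    have "integral {0..real (Suc K) / M} F
            = integral {0..real K / M} F + integral {real K / M..(real K + 1) / M} F"
      using le int[of 0 "(real K + 1) / M"]
      by (subst Henstock_Kurzweil_Integration.integral_combine)
         (auto simp: divide_right_mono add.commute)
    also have "integral {real K / M..(real K + 1) / M} F
                 \<le> integral {real K / M..(real K + 1) / M} (\<lambda>_. F (real K / M) + \<epsilon>)"
      using osc[of K] Suc.prems le int by (intro integral_le) auto
    also have "\<dots> = (F (real K / M) + \<epsilon>) / M"
      using \<open>M > 0\<close> by (simp add: field_simps)
    finally show ?case using Suc by simp
  qed simp
  from this[of M] have "integral {0..1} F \<le> (\<Sum>k<M. (F (real k / M) + \<epsilon>) / M)"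
    using \<open>M > 0\<close> by simp
  also have "\<dots> = (\<Sum>k<M. F (real k / M)) / M + \<epsilon>"
    using \<open>M > 0\<close> by (simp add: sum_divide_distrib[symmetric] sum.distrib add_divide_distrib)
  finally show ?thesis .
qed

text \<open>
  A version of Jensen's inequality \<open>log \<bar>D 0\<bar> \<le> mean of log \<bar>D\<bar>\<close> in which zeros of \<open>D\<close> cause no trouble. The
  integral mean is replaced by the mean over \<open>M\<close> equidistant points, for a suitable rotation \<open>c\<close> of
  the grid: this is the maximum principle for the product of the \<open>M\<close> rotated copies of \<open>D\<close>.
\<close>

lemma Jensen_grid:
  fixes D :: "complex \<Rightarrow> complex" and \<psi> :: "complex \<Rightarrow> real"
  assumes "D holomorphic_on UNIV" "D 0 \<noteq> 0" "R > 0" "M > 0"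
    and bound: "\<And>t. norm t = R \<Longrightarrow> norm (D t) \<le> exp (\<psi> t)"
  shows "\<exists>c. norm c = R \<and> ln (norm (D 0)) \<le> (\<Sum>k<M. \<psi> (c * circ (real k / M))) / M"
proof (rule ccontr)
  assume "\<not> ?thesis"
  hence less: "(\<Sum>k<M. \<psi> (c * circ (real k / M))) < M * ln (norm (D 0))" if "norm c = R" for c
    using that \<open>M > 0\<close> by (force simp: field_simps not_le)
  define G where "G t = (\<Prod>k<M. D (t * circ (real k / M)))" for t
  have holG: "G holomorphic_on UNIV" unfolding G_def
  proof (intro holomorphic_intros)
    fix k
    have "D \<circ> (\<lambda>t. t * circ (real k / M)) holomorphic_on UNIV"
      by (intro holomorphic_on_compose holomorphic_intros) (auto intro: holomorphic_on_subset[OF assms(1)])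
    thus "(\<lambda>t. D (t * circ (real k / M))) holomorphic_on UNIV" by (simp add: o_def)
  qed
  have G0: "norm (G 0) = norm (D 0) ^ M" by (simp add: G_def prod_norm[symmetric] norm_power)
  have G_less: "norm (G t) < norm (G 0)" if "norm t = R" for t
  proof -
    have "norm (G t) \<le> (\<Prod>k<M. exp (\<psi> (t * circ (real k / M))))"
      unfolding G_def
      by (subst prod_norm[symmetric], intro prod_mono) (auto intro!: bound simp: norm_mult that)
    also have "\<dots> = exp (\<Sum>k<M. \<psi> (t * circ (real k / M)))" by (simp add: exp_sum)
    also have "\<dots> < exp (M * ln (norm (D 0)))" using less[OF that] by simp
    also have "\<dots> = norm (G 0)" using assms(2) by (simp add: G0 exp_of_nat_mult)
    finally show ?thesis .
  qed
  have "of_real R \<in> sphere (0 :: complex) R" using \<open>R > 0\<close> by simp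
  hence ne: "sphere 0 R \<noteq> ({} :: complex set)" by blast
  have contG: "continuous_on (sphere 0 R) (\<lambda>t. norm (G t))"
    using holG by (auto intro!: continuous_intros holomorphic_on_imp_continuous_on
        intro: holomorphic_on_subset)
  obtain t0 where t0: "t0 \<in> sphere 0 R" "\<forall>t\<in>sphere 0 R. norm (G t) \<le> norm (G t0)"
    using continuous_attains_sup[OF compact_sphere ne contG] by auto
  have "norm (G 0) \<le> norm (G t0)"
  proof (rule maximum_modulus_frontier[of G "cball 0 R"])
    show "G holomorphic_on interior (cball 0 R)" by (rule holomorphic_on_subset[OF holG]) simp
    show "continuous_on (closure (cball 0 R)) G"
      by (intro holomorphic_on_imp_continuous_on holomorphic_on_subset[OF holG]) simp
  qed (use t0 \<open>R > 0\<close> in auto)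
  with G_less[of t0] t0 show False by auto
qed

text \<open>
  The Schwarz integral formula recovers a holomorphic function in the disc from its real part on the
  boundary: \<open>p t + cnj (p 0)\<close> is the mean of \<open>2 Re (p \<zeta>) \<zeta> / (\<zeta> - t)\<close> over the unit circle. The part with
  \<open>p\<close> is Cauchy's formula, and the part with \<open>cnj p\<close> is the conjugate of Cauchy's formula at \<open>0\<close>
  for \<open>p z / (1 - cnj t z)\<close>, since \<open>cnj \<zeta> = 1 / \<zeta>\<close> on the circle.
\<close>

lemma Schwarz_formula_bound:
  fixes p :: "complex \<Rightarrow> complex"
  assumes "p holomorphic_on UNIV" "norm t \<le> r" "r < 1"
  shows "norm (p t) \<le> norm (p 0) + 2 / (1 - r) * integral {0..1} (\<lambda>x. \<bar>Re (p (circ x))\<bar>)"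
proof -
  have "norm t < 1" using assms by linarith
  have nz: "1 - cnj t * z \<noteq> 0" if "norm z \<le> 1" for z
  proof
    assume "1 - cnj t * z = 0"
    hence "norm t * norm z = 1" by (metis complex_mod_cnj eq_iff_diff_eq_0 norm_mult norm_one)
    with that \<open>norm t < 1\<close> show False
      by (metis mult_left_le norm_ge_zero not_le)
  qed
  have circ_nz: "circ x - t \<noteq> 0" for x using \<open>norm t < 1\<close> norm_circ[of x] by auto
  have I1: "((\<lambda>x. p (circ x) * circ x / (circ x - t)) has_integral p t) {0..1}"
    by (rule Cauchy_formula_circ) fact+
  have I2: "((\<lambda>x. p (circ x) / (1 - cnj t * circ x)) has_integral p 0) {0..1}"
  proof -
    let ?f = "\<lambda>z. p z / (1 - cnj t * z)"
    have "((\<lambda>u. ?f u / (u - 0)) has_contour_integral (2 * of_real pi * \<i> * ?f 0)) (circlepath 0 1)"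
      using nz by (intro Cauchy_integral_circlepath_simple)
        (auto intro!: holomorphic_intros intro: holomorphic_on_subset[OF assms(1)])
    hence "((\<lambda>x. ?f (circ x) / circ x * (2 * of_real pi * \<i> * circ x))
            has_integral (2 * of_real pi * \<i> * p 0)) {0..1}"
      unfolding has_contour_integral vector_derivative_circlepath by (simp add: circlepath circ_def)
    hence *: "((\<lambda>x. 1 / (2 * of_real pi * \<i>) * (?f (circ x) / circ x * (2 * of_real pi * \<i> * circ x)))
            has_integral (1 / (2 * of_real pi * \<i>) * (2 * of_real pi * \<i> * p 0))) {0..1}"
      by (rule has_integral_mult_right)
    have "(\<lambda>x. 1 / (2 * of_real pi * \<i>) * (?f (circ x) / circ x * (2 * of_real pi * \<i> * circ x)))
            = (\<lambda>x. ?f (circ x))"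
      by (simp add: fun_eq_iff)
    moreover have "1 / (2 * of_real pi * \<i>) * (2 * of_real pi * \<i> * p 0) = p 0" by simp
    ultimately show ?thesis using * by (simp only:)
  qed
  have cnj_circ: "cnj (circ x) = 1 / circ x" for x
    using complex_norm_square[of "circ x"] by (simp add: field_simps)
  have "((\<lambda>x. cnj (p (circ x) / (1 - cnj t * circ x))) has_integral cnj (p 0)) {0..1}"
    using has_integral_linear[OF I2 bounded_linear_cnj] by (simp only: o_def)
  also have "(\<lambda>x. cnj (p (circ x) / (1 - cnj t * circ x)))
               = (\<lambda>x. cnj (p (circ x)) * circ x / (circ x - t))"
    using circ_nz by (auto simp: cnj_circ field_simps)
  finally have I3: "((\<lambda>x. cnj (p (circ x)) * circ x / (circ x - t)) has_integral cnj (p 0)) {0..1}" .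
  have I4: "((\<lambda>x. 2 * of_real (Re (p (circ x))) * circ x / (circ x - t)) has_integral (p t + cnj (p 0))) {0..1}"
    using has_integral_add[OF I1 I3]
    by (simp add: complex_add_cnj add_divide_distrib[symmetric] distrib_right[symmetric])
  have cont: "continuous_on {0..1} (\<lambda>x. p (circ x))"
    by (intro continuous_on_compose2[OF holomorphic_on_imp_continuous_on[OF assms(1)]] continuous_intros) auto
  have "norm (p t + cnj (p 0)) = norm (integral {0..1} (\<lambda>x. 2 * of_real (Re (p (circ x))) * circ x / (circ x - t)))"
    using I4 by (simp add: integral_unique)
  also have "\<dots> \<le> integral {0..1} (\<lambda>x. 2 / (1 - r) * \<bar>Re (p (circ x))\<bar>)"
  proof (rule integral_norm_bound_integral)
    fix x :: real
    have "1 - r \<le> norm (circ x - t)" using norm_triangle_ineq2[of "circ x" t] assms by simp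
    hence "2 * \<bar>Re (p (circ x))\<bar> / norm (circ x - t) \<le> 2 * \<bar>Re (p (circ x))\<bar> / (1 - r)"
      using assms circ_nz[of x] by (intro divide_left_mono mult_pos_pos) auto
    thus "norm (2 * of_real (Re (p (circ x))) * circ x / (circ x - t)) \<le> 2 / (1 - r) * \<bar>Re (p (circ x))\<bar>"
      by (simp add: norm_mult norm_divide)
  next
    show "(\<lambda>x. 2 / (1 - r) * \<bar>Re (p (circ x))\<bar>) integrable_on {0..1}"
      using \<open>r < 1\<close> cont by (intro integrable_continuous_real continuous_intros) auto
  qed (rule has_integral_integrable[OF I4])
  also have "\<dots> = 2 / (1 - r) * integral {0..1} (\<lambda>x. \<bar>Re (p (circ x))\<bar>)"
    by simp
  finally have "norm (p t + cnj (p 0)) \<le> \<dots>" .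
  moreover have "norm (p t) \<le> norm (p t + cnj (p 0)) + norm (p 0)"
    using norm_triangle_ineq4[of "p t + cnj (p 0)" "cnj (p 0)"] by simp
  ultimately show ?thesis by simp
qed

text \<open>
  The substitute for the Nevanlinna estimate \<open>T(r, N/D) \<le> T(r, N) + T(r, D) + O(1)\<close>. If both \<open>D\<close> and
  \<open>N = exp p D\<close> are bounded by \<open>exp L\<close>, then \<open>log \<bar>D\<bar> \<le> L - max 0 (Re p)\<close> on the circle, so Jensen's
  inequality bounds the mean of \<open>max 0 (Re p)\<close>. The mean of \<open>Re p\<close> being \<open>Re (p 0)\<close>, this bounds the
  mean of \<open>\<bar>Re p\<bar>\<close>, and the Schwarz formula then bounds \<open>p\<close> itself, linearly in \<open>L\<close>.
\<close>

lemma exponent_of_quotient_bound: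
  fixes p D :: "complex \<Rightarrow> complex"
  assumes hol: "p holomorphic_on UNIV" "D holomorphic_on UNIV" and "D 0 \<noteq> 0" "0 \<le> r" "r < R"
    and D: "\<And>t. norm t = R \<Longrightarrow> norm (D t) \<le> exp L"
    and N: "\<And>t. norm t = R \<Longrightarrow> norm (exp (p t) * D t) \<le> exp L"
    and t: "norm t \<le> r"
  shows "norm (p t) \<le> norm (p 0) + 2 * R / (R - r) * (2 * (L - ln (norm (D 0)) + 1) + norm (p 0))"
proof -
  define \<phi> where "\<phi> = (\<lambda>z. max 0 (Re (p z)))"
  have "R > 0" using assms by linarith
  have contp: "continuous_on S p" for S
    using hol(1) by (auto intro: holomorphic_on_imp_continuous_on holomorphic_on_subset)
  have "uniformly_continuous_on (sphere 0 R) \<phi>" unfolding \<phi>_def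
    by (intro compact_uniformly_continuous continuous_intros contp) auto
  then obtain \<delta> where \<delta>: "\<delta> > 0"
    "\<And>x y. x \<in> sphere 0 R \<Longrightarrow> y \<in> sphere 0 R \<Longrightarrow> dist y x < \<delta> \<Longrightarrow> dist (\<phi> y) (\<phi> x) < 1"
    unfolding uniformly_continuous_on_def by (metis zero_less_one)
  have "uniformly_continuous_on {0..1} circ"
    by (intro compact_uniformly_continuous continuous_intros) auto
  then obtain d where d: "d > 0"
    "\<And>x y. x \<in> {0..1} \<Longrightarrow> y \<in> {0..1} \<Longrightarrow> dist y x < d \<Longrightarrow> dist (circ y) (circ x) < \<delta> / R"
    unfolding uniformly_continuous_on_def using \<delta>(1) \<open>R > 0\<close> by (metis divide_pos_pos)
  \<comment> \<open>The grid is chosen so fine that \<open>\<phi>\<close> varies by less than 1 between neighbouring grid points,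
    whatever the rotation \<open>c\<close>; that is the price \<open>+ 1\<close> for passing from the grid mean to the integral.\<close>
  obtain M :: nat where M: "M > 0" "1 / real M < d"
    using reals_Archimedean[OF d(1)] by (auto simp: inverse_eq_divide intro: that[of "Suc _"])
  have "\<exists>c. norm c = R \<and> ln (norm (D 0)) \<le> (\<Sum>k<M. L - \<phi> (c * circ (real k / M))) / M"
  proof (rule Jensen_grid)
    fix t :: complex assume t: "norm t = R"
    show "norm (D t) \<le> exp (L - \<phi> t)"
      using D[OF t] N[OF t]
      by (auto simp: \<phi>_def norm_mult norm_exp_eq_Re exp_diff max_def field_simps)
  qed (use hol \<open>D 0 \<noteq> 0\<close> \<open>R > 0\<close> M in auto)
  then obtain c where c: "norm c = R"
    and "ln (norm (D 0)) \<le> (\<Sum>k<M. L - \<phi> (c * circ (real k / M))) / M" by auto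
  hence grid: "(\<Sum>k<M. \<phi> (c * circ (real k / M))) / M \<le> L - ln (norm (D 0))"
    using \<open>M > 0\<close> by (simp add: sum_subtractf diff_divide_distrib)
  have cont: "continuous_on S (\<lambda>x. p (c * circ x))" for S
    by (rule continuous_on_compose2[OF contp[of UNIV]]) (auto intro!: continuous_intros)
  have mean_pos: "integral {0..1} (\<lambda>x. \<phi> (c * circ x)) \<le> L - ln (norm (D 0)) + 1"
  proof -
    have "integral {0..1} (\<lambda>x. \<phi> (c * circ x)) \<le> (\<Sum>k<M. \<phi> (c * circ (real k / M))) / M + 1"
    proof (rule grid_integral_le)
      fix k x assume k: "k < M" and x: "real k / M \<le> x" "x \<le> (real k + 1) / M"
      have "(real k + 1) / M \<le> 1" using k by (simp add: field_simps)
      with x(2) have "x \<le> 1" by (rule order_trans)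
      hence "real k / M \<in> {0..1}" "x \<in> {0..1}"
        using x k order_trans[OF _ x(1), of 0] by auto
      moreover have "dist x (real k / M) < d"
        using x M(2) by (auto simp: dist_real_def add_divide_distrib)
      ultimately have "dist (circ x) (circ (real k / M)) < \<delta> / R" by (intro d(2))
      hence "dist (c * circ x) (c * circ (real k / M)) < \<delta>"
        using c \<open>R > 0\<close>
        by (simp add: dist_norm norm_mult right_diff_distrib[symmetric] pos_less_divide_eq mult.commute)
      hence "dist (\<phi> (c * circ x)) (\<phi> (c * circ (real k / M))) < 1"
        using c by (intro \<delta>(2)) (auto simp: norm_mult)
      thus "\<phi> (c * circ x) \<le> \<phi> (c * circ (real k / M)) + 1" by (simp add: dist_real_def)
    qed (use M in \<open>auto simp: \<phi>_def intro!: continuous_intros cont\<close>)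
    with grid show ?thesis by simp
  qed
  have holc: "(\<lambda>t. p (c * t)) holomorphic_on UNIV"
  proof -
    have "p \<circ> (\<lambda>t. c * t) holomorphic_on UNIV"
      by (intro holomorphic_on_compose holomorphic_intros) (auto intro: holomorphic_on_subset[OF hol(1)])
    thus ?thesis by (simp add: o_def)
  qed
  have "((\<lambda>x. p (c * circ x)) has_integral p 0) {0..1}"
    using Cauchy_formula_circ[OF holc, of 0] by simp
  from has_integral_linear[OF this bounded_linear_Re]
  have mean: "integral {0..1} (\<lambda>x. Re (p (c * circ x))) = Re (p 0)"
    by (simp add: o_def integral_unique)
  have "integral {0..1} (\<lambda>x. \<bar>Re (p (c * circ x))\<bar>)
          = integral {0..1} (\<lambda>x. 2 * \<phi> (c * circ x) - Re (p (c * circ x)))"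
    by (intro arg_cong[of _ _ "integral {0..1}"]) (auto simp: \<phi>_def max_def)
  also have "\<dots> = 2 * integral {0..1} (\<lambda>x. \<phi> (c * circ x)) - Re (p 0)"
    by (subst integral_diff) (auto simp: \<phi>_def mean intro!: integrable_continuous_real continuous_intros cont)
  also have "\<dots> \<le> 2 * (L - ln (norm (D 0)) + 1) + norm (p 0)"
  proof (intro diff_le_eq[THEN iffD2])
    have "2 * integral {0..1} (\<lambda>x. \<phi> (c * circ x)) \<le> 2 * (L - ln (norm (D 0)) + 1)"
      using mean_pos by (rule mult_left_mono) simp
    moreover have "0 \<le> norm (p 0) + Re (p 0)" using abs_Re_le_cmod[of "p 0"] by linarith
    ultimately show "2 * integral {0..1} (\<lambda>x. \<phi> (c * circ x))
                       \<le> 2 * (L - ln (norm (D 0)) + 1) + norm (p 0) + Re (p 0)"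
      using add_mono by fastforce
  qed
  finally have abs: "integral {0..1} (\<lambda>x. \<bar>Re (p (c * circ x))\<bar>)
      \<le> 2 * (L - ln (norm (D 0)) + 1) + norm (p 0)" .
  have "c \<noteq> 0" using c \<open>R > 0\<close> by auto
  have "1 - r / R = (R - r) / R" using \<open>R > 0\<close> by (simp add: diff_divide_distrib)
  hence factor: "2 / (1 - r / R) = 2 * R / (R - r)" by simp
  have "norm (p (c * (t / c))) \<le> norm (p (c * 0)) + 2 / (1 - r / R) * integral {0..1} (\<lambda>x. \<bar>Re (p (c * circ x))\<bar>)"
  proof (rule Schwarz_formula_bound[OF holc])
    show "norm (t / c) \<le> r / R" using t c \<open>R > 0\<close> by (simp add: norm_divide divide_right_mono)
    show "r / R < 1" using \<open>r < R\<close> \<open>R > 0\<close> by simp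
  qed
  also have "\<dots> \<le> norm (p (c * 0)) + 2 / (1 - r / R) * (2 * (L - ln (norm (D 0)) + 1) + norm (p 0))"
    unfolding factor using \<open>r < R\<close> \<open>R > 0\<close> by (intro add_left_mono mult_left_mono[OF abs]) simp
  finally show ?thesis using \<open>c \<noteq> 0\<close> by (simp add: factor)
qed

section \<open>Linked logarithms differ by constants\<close>

text \<open>
  Borel's growth lemma. If the value doubled at each step \<open>s \<mapsto> s + 1 / m s\<close>, the step lengths would be
  dominated by a geometric series, and \<open>m\<close> would be unbounded on a bounded interval.
\<close>

lemma Borel_growth:
  fixes m :: "real \<Rightarrow> real"
  assumes mono: "\<And>x y. x \<le> y \<Longrightarrow> m x \<le> m y" and pos: "\<And>x. m x \<ge> 1"
  shows "\<exists>s\<ge>s0. m (s + 1 / m s) \<le> 2 * m s"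
proof (rule ccontr)
  assume "\<not> ?thesis"
  hence double: "m (s + 1 / m s) > 2 * m s" if "s \<ge> s0" for s using that by force
  define \<sigma> where "\<sigma> k = ((\<lambda>s. s + 1 / m s) ^^ k) s0" for k
  have \<sigma>_Suc: "\<sigma> (Suc k) = \<sigma> k + 1 / m (\<sigma> k)" for k by (simp add: \<sigma>_def)
  have pos': "1 / m x > 0" for x using pos[of x] by simp
  have \<sigma>_ge: "\<sigma> k \<ge> s0" for k
  proof (induction k)
    case (Suc k) thus ?case using pos'[of "\<sigma> k"] unfolding \<sigma>_Suc by linarith
  qed (simp add: \<sigma>_def)
  have m_ge: "m (\<sigma> k) \<ge> 2 ^ k" for k
  proof (induction k)
    case (Suc k) thus ?case using double[OF \<sigma>_ge[of k]] by (simp add: \<sigma>_Suc)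
  qed (use pos in simp)
  have \<sigma>_le: "\<sigma> k \<le> s0 + 2 - 2 / 2 ^ k" for k
  proof (induction k)
    case (Suc k)
    have "1 / m (\<sigma> k) \<le> 1 / 2 ^ k" using m_ge[of k] by (intro frac_le) auto
    thus ?case using Suc by (simp add: \<sigma>_Suc)
  qed (simp add: \<sigma>_def)
  obtain k where k: "m (s0 + 2) < 2 ^ k" using real_arch_pow[of 2 "m (s0 + 2)"] by auto
  have "\<sigma> k \<le> s0 + 2" using \<sigma>_le[of k] by (rule order_trans) simp
  from mono[OF this] m_ge[of k] k show False by linarith
qed

text \<open>
  It suffices that the growth is sublinear along an unbounded set of radii, because Cauchy's estimate
  for the derivative at a point uses one radius at a time.
\<close>

lemma Liouville_sublinear:
  assumes "line_holomorphic p"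
    and small: "\<And>\<epsilon> r0. \<epsilon> > 0 \<Longrightarrow> \<exists>r\<ge>r0. \<forall>z\<in>cball z0 r. norm (p z) \<le> \<epsilon> * r"
  shows "p z = p z'"
proof -
  have zero: "ddir v p z = 0" for v z
  proof (rule ccontr)
    assume nz: "ddir v p z \<noteq> 0"
    hence v: "v \<noteq> 0" by (auto simp: ddir_def)
    define \<epsilon> where "\<epsilon> = norm (ddir v p z) / (4 * norm v)"
    have "\<epsilon> > 0" using nz v by (simp add: \<epsilon>_def)
    from small[OF this, of "2 * dist z0 z + 1"]
    obtain r where r: "r \<ge> 2 * dist z0 z + 1" "\<And>z. z \<in> cball z0 r \<Longrightarrow> norm (p z) \<le> \<epsilon> * r" by auto
    have "r > 0" using r(1) zero_le_dist[of z0 z] by linarith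
    have "norm (ddir v p z) \<le> \<epsilon> * r / (r / (2 * norm v))"
    proof (rule norm_ddir_le[OF assms(1)])
      show "r / (2 * norm v) > 0" using \<open>r > 0\<close> v by simp
      fix t :: complex assume "norm t = r / (2 * norm v)"
      hence "norm (t *s v) = r / 2" using v by (simp add: norm_vector_smult)
      hence "dist z0 (z + t *s v) \<le> dist z0 z + r / 2"
        using dist_triangle[of z0 "z + t *s v" z] by (simp add: dist_norm norm_minus_commute)
      thus "norm (p (z + t *s v)) \<le> \<epsilon> * r" using r(1) by (intro r(2)) auto
    qed
    also have "\<dots> = norm (ddir v p z) / 2" using \<open>r > 0\<close> v by (simp add: \<epsilon>_def field_simps)
    finally show False using nz by simp
  qed
  show ?thesis using constant_if_ddir_zero[OF assms(1) zero, of z' "z - z'"] by simp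
qed

lemma line_holomorphic_prod:
  "(\<And>e. e \<in> E \<Longrightarrow> line_holomorphic (F e)) \<Longrightarrow> line_holomorphic (\<lambda>z. \<Prod>e\<in>E. F e z)"
  unfolding line_holomorphic_def by (auto intro!: continuous_intros holomorphic_intros)

text \<open>
  All the estimates below are centred at one point, which has to be a non-zero of all the
  denominators simultaneously.
\<close>

lemma common_nonvanishing_point:
  fixes F :: "'e \<Rightarrow> complex ^ 'n \<Rightarrow> complex"
  assumes "finite E" "\<And>e. e \<in> E \<Longrightarrow> line_holomorphic (F e)" "\<And>e. e \<in> E \<Longrightarrow> \<exists>z. F e z \<noteq> 0"
  shows "\<exists>z. \<forall>e\<in>E. F e z \<noteq> 0"
proof -
  have "\<exists>z. (\<Prod>e\<in>E. F e z) \<noteq> 0" using assms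
  proof (induction E rule: finite_induct)
    case (insert e E)
    then obtain a b where ab: "F e a \<noteq> 0" "(\<Prod>e\<in>E. F e b) \<noteq> 0" by (metis insertCI)
    have "line_holomorphic (\<lambda>z. \<Prod>e\<in>E. F e z)" "line_holomorphic (F e)"
      using insert.prems by (auto intro!: line_holomorphic_prod)
    from nonvanishing_point_mult[OF this(2,1) ab] show ?case using insert.hyps by simp
  qed simp
  thus ?thesis using assms(1) by (auto simp: prod_zero_iff)
qed

text \<open>
  Summing over the family instead of taking the largest member costs only a constant factor and
  reduces every property to that of a single supremum.
\<close>

definition max_modulus :: "('i::finite \<Rightarrow> complex ^ 'n \<Rightarrow> complex) \<Rightarrow> complex ^ 'n \<Rightarrow> real \<Rightarrow> real" where
  "max_modulus h z0 r = (\<Sum>i\<in>UNIV. SUP z\<in>cball z0 r. norm (h i z))"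

lemma bdd_above_norm_cball:
  fixes f :: "complex ^ 'n \<Rightarrow> complex"
  assumes "line_holomorphic f"
  shows "bdd_above ((\<lambda>z. norm (f z)) ` cball z0 r)"
proof -
  have "compact ((\<lambda>z. norm (f z)) ` cball z0 r)"
    using assms by (intro compact_continuous_image continuous_intros)
      (auto simp: line_holomorphic_def intro: continuous_on_subset)
  thus ?thesis by (simp add: compact_imp_bounded bounded_imp_bdd_above)
qed

lemma norm_le_max_modulus:
  assumes "\<And>i. line_holomorphic (h i)" "z \<in> cball z0 r"
  shows "norm (h i z) \<le> max_modulus h z0 r"
proof -
  have le: "norm (h j z) \<le> (SUP z\<in>cball z0 r. norm (h j z))" for j
    using assms by (intro cSUP_upper bdd_above_norm_cball)
  have "norm (h i z) \<le> (SUP z\<in>cball z0 r. norm (h i z))" by (rule le)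
  also have "\<dots> \<le> max_modulus h z0 r" unfolding max_modulus_def
    by (rule member_le_sum) (auto intro: order_trans[OF norm_ge_zero le])
  finally show ?thesis .
qed

lemma max_modulus_mono:
  assumes "\<And>i. line_holomorphic (h i)" "0 \<le> r" "r \<le> s"
  shows "max_modulus h z0 r \<le> max_modulus h z0 s"
  unfolding max_modulus_def
  using assms by (intro sum_mono cSUP_subset_mono bdd_above_norm_cball) auto

lemma max_modulus_le:
  fixes h :: "'i::finite \<Rightarrow> complex ^ 'n \<Rightarrow> complex"
    and B :: real
  assumes "0 \<le> r" "\<And>i z. z \<in> cball z0 r \<Longrightarrow> norm (h i z) \<le> B"
  shows "max_modulus h z0 r \<le> CARD('i) * B"
proof -
  have "max_modulus h z0 r \<le> (\<Sum>i\<in>(UNIV::'i set). B)" unfolding max_modulus_def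
    using assms by (intro sum_mono cSUP_least) auto
  thus ?thesis by simp
qed

text \<open>
  Since \<open>exp (h i - h j)\<close> is the quotient of the derivatives of \<open>h j\<close> and \<open>h i\<close>, which Cauchy's
  estimate bounds by the growth \<open>M\<close> of the logarithms on a slightly larger ball, the difference
  \<open>h i - h j\<close> is bounded by a power of \<open>ln M\<close>. The larger radius \<open>r exp (1 / ln (M r))\<close> is the one for which
  Borel's lemma controls \<open>M\<close>. It is so close to \<open>r\<close> that a factor \<open>ln M\<close> is lost, whence the square.
  The summand \<open>r + 3\<close> in \<open>M\<close> makes \<open>ln M\<close> at least 1 and lets it dominate \<open>ln r\<close>.
\<close>

lemma linked_logarithms_estimate:
  fixes h :: "'n \<Rightarrow> complex ^ 'n \<Rightarrow> complex" and z0 :: "complex ^ 'n"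
  defines "M \<equiv> \<lambda>r. r + 3 + max_modulus h z0 r"
  assumes hol: "\<And>i. line_holomorphic (h i)"
    and edge: "\<And>z. exp (h i z - h j z) * ddir (axis j 1) (h i) z = ddir (axis i 1) (h j) z"
    and nz: "ddir (axis j 1) (h i) z0 \<noteq> 0"
  shows "\<exists>C\<ge>0. \<forall>r\<ge>1. M (r * exp (1 / ln (M r))) \<le> M r ^ 2 \<longrightarrow>
           (\<forall>z\<in>cball z0 r. norm (h i z - h j z) \<le> C * ln (M r) ^ 2)"
proof -
  define p where "p z = h i z - h j z" for z
  have holp: "line_holomorphic p" unfolding p_def by (intro line_holomorphic_diff hol)
  define q where "q = norm (p z0)"
  define \<kappa> where "\<kappa> = \<bar>ln (norm (ddir (axis j 1) (h i) z0))\<bar>"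
  define C where "C = q + 12 * (10 + 2 * \<kappa> + q)"
  have q: "q \<ge> 0" "\<kappa> \<ge> 0" by (auto simp: q_def \<kappa>_def)
  have "norm (p z) \<le> C * ln (M r) ^ 2"
    if r: "r \<ge> 1" "M (r * exp (1 / ln (M r))) \<le> M r ^ 2" and z: "z \<in> cball z0 r" for r z
  proof -
    define L where "L = ln (M r)"
    have "0 \<le> norm (h i z)" by simp
    also have "\<dots> \<le> max_modulus h z0 r" using z by (intro norm_le_max_modulus hol)
    finally have Mr: "M r \<ge> 4" using r by (simp add: M_def)
    have "exp 1 \<le> M r" using Mr exp_le by linarith
    hence L: "L \<ge> 1" unfolding L_def using Mr by (subst ln_ge_iff) auto
    have M_eq: "M r = exp L" using Mr by (simp add: L_def)
    define R where "R = r * exp (1 / L)"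
    define R1 where "R1 = (r + R) / 2"
    have "1 / L \<le> exp (1 / L) - 1" using exp_ge_add_one_self[of "1 / L"] by linarith
    hence "r * (1 / L) \<le> r * (exp (1 / L) - 1)" using r by (intro mult_left_mono) auto
    hence Rr: "r / L \<le> R - r" by (simp add: R_def algebra_simps)
    have "exp (1 / L) \<le> exp 1" using L by simp
    hence "exp (1 / L) \<le> 3" using exp_le by linarith
    hence R3: "R \<le> 3 * r" using r by (simp add: R_def)
    have "r / L > 0" using r L by simp
    with Rr have "r < R" by linarith
    hence R1: "r < R1" "R1 < R" by (auto simp: R1_def)
    have gap: "r / (2 * L) \<le> R1 - r" "r / (2 * L) \<le> R - R1"
    proof -
      have "r / (2 * L) = (r / L) / 2" by simp
      with Rr show "r / (2 * L) \<le> R1 - r" "r / (2 * L) \<le> R - R1" by (auto simp: R1_def field_simps)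
    qed
    have hM: "norm (h k \<zeta>) \<le> exp (2 * L)" if "\<zeta> \<in> cball z0 R" for k \<zeta>
    proof -
      have "norm (h k \<zeta>) \<le> M R"
        using norm_le_max_modulus[where h = h and i = k, OF hol that] R1 r by (simp add: M_def)
      also have "\<dots> \<le> exp (2 * L)" using r(2) unfolding R_def L_def[symmetric]
        by (simp add: M_eq exp_double)
      finally show ?thesis .
    qed
    have deriv: "norm (ddir (axis a 1) (h k) \<zeta>) \<le> exp (4 * L)" if "dist z0 \<zeta> = R1" for a k \<zeta>
    proof -
      have "norm (ddir (axis a 1) (h k) \<zeta>) \<le> exp (2 * L) / (R - R1)"
      proof (rule norm_ddir_le[OF hol])
        fix t :: complex assume t: "norm t = R - R1"
        have "norm (t *s axis a 1 :: complex ^ 'n) = R - R1" using t by (simp add: norm_vector_smult)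
        hence "dist z0 (\<zeta> + t *s axis a 1) \<le> R1 + (R - R1)"
          using dist_triangle[of z0 "\<zeta> + t *s axis a 1" \<zeta>] that by (simp add: dist_norm norm_minus_commute)
        thus "norm (h k (\<zeta> + t *s axis a 1)) \<le> exp (2 * L)" by (intro hM) simp
      qed (use R1 in simp)
      also have "\<dots> \<le> exp (2 * L) / (1 / (2 * L))"
      proof (intro divide_left_mono)
        have "1 / (2 * L) \<le> r / (2 * L)" using r L by (intro divide_right_mono) auto
        thus "1 / (2 * L) \<le> R - R1" using gap by linarith
      qed (use R1 L in auto)
      also have "\<dots> \<le> exp (2 * L) * exp (2 * L)"
      proof -
        have "2 * L \<le> exp (2 * L)" using exp_ge_add_one_self[of "2 * L"] by linarith
        thus ?thesis by simp
      qed
      also have "\<dots> = exp (4 * L)" by (simp add: exp_add[symmetric])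
      finally show ?thesis .
    qed
    \<comment> \<open>The one-variable estimate is applied on the complex line through \<open>z0\<close> and \<open>z\<close>, on the disc of
      radius \<open>R1\<close>, midway between \<open>r\<close> and \<open>R\<close>; the remaining gap \<open>R - R1\<close> is used for Cauchy's estimate.\<close>
    obtain v t where v: "norm v = 1" "z = z0 + t *s v" "norm t \<le> r"
    proof (cases "z = z0")
      case True
      show ?thesis using True r by (intro that[of "axis i 1" 0]) auto
    next
      case False
      define d where "d = norm (z - z0)"
      have "d > 0" using False by (simp add: d_def)
      show ?thesis
      proof (rule that[of "of_real (1 / d) *s (z - z0)" "of_real d"])
        show "norm (of_real (1 / d) *s (z - z0)) = 1"
          using \<open>d > 0\<close> unfolding norm_vector_smult d_def[symmetric] by (simp add: norm_divide)
        show "z = z0 + of_real d *s (of_real (1 / d) *s (z - z0))"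
          using \<open>d > 0\<close> unfolding vector_smult_assoc by (simp add: of_real_mult[symmetric] del: of_real_mult)
        show "norm (of_real d :: complex) \<le> r" using z by (simp add: d_def dist_norm norm_minus_commute)
      qed
    qed
    have on_line: "dist z0 (z0 + s *s v) = norm s" for s
      using v(1) by (simp add: dist_norm norm_vector_smult)
    have "norm (p (z0 + t *s v)) \<le> norm (p (z0 + 0 *s v)) + 2 * R1 / (R1 - r) *
            (2 * (4 * L - ln (norm (ddir (axis j 1) (h i) (z0 + 0 *s v))) + 1) + norm (p (z0 + 0 *s v)))"
    proof (rule exponent_of_quotient_bound)
      show "(\<lambda>t. p (z0 + t *s v)) holomorphic_on UNIV" using holp by (simp add: line_holomorphic_def)
      show "(\<lambda>t. ddir (axis j 1) (h i) (z0 + t *s v)) holomorphic_on UNIV"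
        using ddir_line_holomorphic[OF hol] by (simp add: line_holomorphic_def)
      show "norm (exp (p (z0 + s *s v)) * ddir (axis j 1) (h i) (z0 + s *s v)) \<le> exp (4 * L)"
        if "norm s = R1" for s
        unfolding p_def edge using that by (intro deriv) (simp add: on_line)
    qed (use nz r R1 v on_line deriv in auto)
    hence "norm (p z) \<le> q + 2 * R1 / (R1 - r) * (2 * (4 * L - ln (norm (ddir (axis j 1) (h i) z0)) + 1) + q)"
      using v(2) by (simp add: q_def)
    also have "\<dots> \<le> q + 2 * R1 / (R1 - r) * (2 * (4 * L + \<kappa> + 1) + q)"
    proof (intro add_left_mono mult_left_mono)
      have "- ln (norm (ddir (axis j 1) (h i) z0)) \<le> \<kappa>" unfolding \<kappa>_def by linarith
      thus "2 * (4 * L - ln (norm (ddir (axis j 1) (h i) z0)) + 1) + q \<le> 2 * (4 * L + \<kappa> + 1) + q"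
        by simp
    qed (use R1 r in simp)
    also have "\<dots> \<le> q + 12 * L * (2 * (4 * L + \<kappa> + 1) + q)"
    proof (intro add_left_mono mult_right_mono)
      have "2 * R1 / (R1 - r) \<le> 2 * (3 * r) / (r / (2 * L))"
        using gap R1 R3 r L by (intro frac_le) auto
      also have "\<dots> = 12 * L" using r L by (simp add: field_simps)
      finally show "2 * R1 / (R1 - r) \<le> 12 * L" .
    qed (use q L in auto)
    also have "\<dots> \<le> q * L\<^sup>2 + 12 * L * ((10 + 2 * \<kappa> + q) * L)"
    proof (intro add_mono mult_left_mono)
      show "q \<le> q * L\<^sup>2" using q L by (simp add: mult_le_cancel_left1)
      have "2 * \<kappa> \<le> 2 * \<kappa> * L" "q \<le> q * L" using q L by (auto simp: mult_le_cancel_left1)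
      thus "2 * (4 * L + \<kappa> + 1) + q \<le> (10 + 2 * \<kappa> + q) * L" using L by (simp add: algebra_simps)
    qed (use L in auto)
    also have "\<dots> = C * ln (M r) ^ 2" by (simp add: C_def L_def power2_eq_square algebra_simps)
    finally show ?thesis .
  qed
  moreover have "C \<ge> 0" using q by (simp add: C_def)
  ultimately show ?thesis unfolding p_def by blast
qed


text \<open>
  The growth hypothesis says that the logarithms are controlled by a polynomial and by their
  differences along \<open>E\<close>. These differences are only \<open>O((ln M)\<^sup>2)\<close> on the radii provided by Borel's lemma, so
  there \<open>M r \<le> O(r^(d+1)) + O((ln M r)\<^sup>2)\<close>, which forces \<open>ln M r = O(ln r)\<close>. The differences are then
  \<open>O((ln r)\<^sup>2)\<close> on an unbounded set of radii, and Liouville's theorem makes them constant.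
\<close>

lemma linked_logarithms_differ_by_constants:
  fixes h :: "'n \<Rightarrow> complex ^ 'n \<Rightarrow> complex" and E :: "('n \<times> 'n) set"
  assumes hol: "\<And>i. line_holomorphic (h i)"
    and edge: "\<And>i j z. (i, j) \<in> E \<Longrightarrow> exp (h i z - h j z) * ddir (axis j 1) (h i) z = ddir (axis i 1) (h j) z"
    and nz: "\<And>i j. (i, j) \<in> E \<Longrightarrow> \<exists>z. ddir (axis j 1) (h i) z \<noteq> 0"
    and A: "A \<ge> 0"
    and growth: "\<And>i z \<Phi>. (\<And>a b. (a, b) \<in> E \<Longrightarrow> norm (h a z - h b z) \<le> \<Phi>) \<Longrightarrow> \<Phi> \<ge> 0 \<Longrightarrow>
                   norm (h i z) \<le> A * (1 + norm z) ^ d + A * \<Phi>"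
    and ij: "(i, j) \<in> E"
  shows "h i z - h j z = h i z' - h j z'"
proof -
  have "\<exists>z0. \<forall>e\<in>E. ddir (axis (snd e) 1) (h (fst e)) z0 \<noteq> 0"
    using nz by (intro common_nonvanishing_point) (auto intro!: ddir_line_holomorphic hol)
  then obtain z0 where z0: "\<And>i j. (i, j) \<in> E \<Longrightarrow> ddir (axis j 1) (h i) z0 \<noteq> 0" by force
  define M where "M = (\<lambda>r. r + 3 + max_modulus h z0 r)"
  have M_ge: "M r \<ge> r + 3" if "r \<ge> 0" for r
  proof -
    have "0 \<le> norm (h i z0)" by simp
    also have "\<dots> \<le> max_modulus h z0 r" using that by (intro norm_le_max_modulus hol) auto
    finally show ?thesis by (simp add: M_def)
  qed
  have M_mono: "M r \<le> M s" if "0 \<le> r" "r \<le> s" for r s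
    using max_modulus_mono[where h = h and ?z0.0 = z0, OF hol that] that by (simp add: M_def)
  have "\<forall>e\<in>E. \<exists>C\<ge>0. \<forall>r\<ge>1. M (r * exp (1 / ln (M r))) \<le> M r ^ 2 \<longrightarrow>
           (\<forall>z\<in>cball z0 r. norm (h (fst e) z - h (snd e) z) \<le> C * ln (M r) ^ 2)"
    unfolding M_def using edge z0 by (auto intro!: linked_logarithms_estimate hol)
  then obtain C where C: "\<And>e. e \<in> E \<Longrightarrow> C e \<ge> 0"
    "\<And>e r z. e \<in> E \<Longrightarrow> r \<ge> 1 \<Longrightarrow> M (r * exp (1 / ln (M r))) \<le> M r ^ 2 \<Longrightarrow> z \<in> cball z0 r \<Longrightarrow>
        norm (h (fst e) z - h (snd e) z) \<le> C e * ln (M r) ^ 2"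
    by metis
  define K where "K = (\<Sum>e\<in>E. C e)"
  have K: "K \<ge> 0" "\<And>e. e \<in> E \<Longrightarrow> C e \<le> K"
    using C(1) by (auto simp: K_def intro!: sum_nonneg member_le_sum)
  have est: "norm (h a z - h b z) \<le> K * ln (M r) ^ 2"
    if "(a, b) \<in> E" "r \<ge> 1" "M (r * exp (1 / ln (M r))) \<le> M r ^ 2" "z \<in> cball z0 r" for a b r z
  proof -
    have "norm (h a z - h b z) \<le> C (a, b) * ln (M r) ^ 2" using C(2)[OF that] by simp
    also have "\<dots> \<le> K * ln (M r) ^ 2" using K(2)[OF that(1)] by (rule mult_right_mono) simp
    finally show ?thesis .
  qed
  define B1 where "B1 = 4 + CARD('n) * A * (2 + norm z0) ^ d"
  define B where "B = B1 + CARD('n) * A * K * 8"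
  have B1: "B1 \<ge> 4" using A by (simp add: B1_def)
  have BB1: "B - B1 \<ge> 0" using A K(1) by (simp add: B_def)
  with B1 have B: "B \<ge> 4" by linarith
  have log_bound: "ln (M r) \<le> 2 * ln B + 2 * (d + 1) * ln r"
    if r: "r \<ge> 1" "M (r * exp (1 / ln (M r))) \<le> M r ^ 2" for r
  proof -
    \<comment> \<open>With \<open>x\<close> the square root of \<open>M r\<close>, the term \<open>(ln M r)\<^sup>2\<close> is at most \<open>8 x\<close>, and the
      inequality becomes quadratic in \<open>x\<close>.\<close>
    define x where "x = exp (ln (M r) / 2)"
    have Mr: "M r \<ge> 4" using M_ge[of r] r by linarith
    have x2: "x ^ 2 = M r" using Mr by (simp add: x_def power2_eq_square exp_add[symmetric])
    have x1: "x \<ge> 1" using Mr by (simp add: x_def)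
    have lnx: "ln (M r) ^ 2 \<le> 8 * x"
    proof -
      have "1 + ln (M r) / 2 + (ln (M r) / 2) ^ 2 / 2 \<le> x"
        unfolding x_def using Mr by (intro exp_lower_Taylor_quadratic) simp
      moreover have "ln (M r) \<ge> 0" using Mr by simp
      ultimately show ?thesis by (simp add: power_divide)
    qed
    have "max_modulus h z0 r \<le> CARD('n) * (A * ((2 + norm z0) * r) ^ d + A * (K * ln (M r) ^ 2))"
    proof (rule max_modulus_le)
      fix k z assume z: "z \<in> cball z0 r"
      have "norm z \<le> norm z0 + r" using z norm_triangle_ineq4[of z0 "z0 - z"] by (simp add: dist_norm)
      moreover have "norm z0 \<le> norm z0 * r" using r by (simp add: mult_le_cancel_left1)
      ultimately have "1 + norm z \<le> (2 + norm z0) * r" using r by (simp add: algebra_simps)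
      hence "A * (1 + norm z) ^ d \<le> A * ((2 + norm z0) * r) ^ d"
        using A by (intro mult_left_mono power_mono) auto
      moreover have "norm (h k z) \<le> A * (1 + norm z) ^ d + A * (K * ln (M r) ^ 2)"
        using est[OF _ r z] K(1) by (intro growth) auto
      ultimately show "norm (h k z) \<le> A * ((2 + norm z0) * r) ^ d + A * (K * ln (M r) ^ 2)" by linarith
    qed (use r in auto)
    hence "M r \<le> r + 3 + CARD('n) * (A * ((2 + norm z0) * r) ^ d + A * (K * ln (M r) ^ 2))"
      by (simp add: M_def)
    also have "\<dots> \<le> r + 3 + CARD('n) * (A * ((2 + norm z0) * r) ^ d + A * (K * (8 * x)))"
      using A K(1) lnx by (intro add_left_mono mult_left_mono) auto
    also have "\<dots> = (r + 3) + (B1 - 4) * r ^ d + CARD('n) * A * K * 8 * x"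
      unfolding B1_def power_mult_distrib by (simp add: algebra_simps)
    also have "\<dots> \<le> 4 * r ^ (d + 1) + (B1 - 4) * r ^ (d + 1) + CARD('n) * A * K * 8 * (x * r ^ (d + 1))"
    proof (intro add_mono mult_left_mono)
      have "1 \<le> r ^ (d + 1)" "r \<le> r ^ (d + 1)" using r one_le_power[of r d]
        by (auto simp: mult_ge1_I mult_le_cancel_left1)
      thus "r + 3 \<le> 4 * r ^ (d + 1)" by linarith
      show "r ^ d \<le> r ^ (d + 1)" using r by (intro power_increasing) auto
      show "x \<le> x * r ^ (d + 1)" using x1 \<open>1 \<le> r ^ (d + 1)\<close> by (simp add: mult_le_cancel_left1)
    qed (use A K(1) B1 in auto)
    also have "\<dots> = B1 * r ^ (d + 1) + (B - B1) * (x * r ^ (d + 1))" by (simp add: B_def algebra_simps)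
    also have "\<dots> \<le> B1 * (x * r ^ (d + 1)) + (B - B1) * (x * r ^ (d + 1))"
      using B1 x1 r by (intro add_right_mono mult_left_mono) auto
    also have "\<dots> = x * (B * r ^ (d + 1))" by (simp add: algebra_simps)
    finally have "x * x \<le> x * (B * r ^ (d + 1))" using x2 by (simp add: power2_eq_square)
    hence "x \<le> B * r ^ (d + 1)" using x1 by (subst (asm) mult_le_cancel_left_pos) auto
    hence "ln x \<le> ln (B * r ^ (d + 1))" using x1 by (intro ln_mono) auto
    also have "\<dots> = ln B + (d + 1) * ln r" using B r by (simp add: ln_mult ln_realpow algebra_simps)
    finally show ?thesis by (simp add: x_def algebra_simps)
  qed
  define K' where "K' = K * (2 * ln B + 2 * (d + 1)) ^ 2"
  have final: "norm (h i z - h j z) \<le> K' * ln r ^ 2"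
    if r: "r \<ge> 3" "M (r * exp (1 / ln (M r))) \<le> M r ^ 2" and z: "z \<in> cball z0 r" for r z
  proof -
    have "1 \<le> ln r" using r(1) exp_le by (subst ln_ge_iff) auto
    moreover have "0 \<le> 2 * ln B" using B by simp
    ultimately have "2 * ln B \<le> 2 * ln B * ln r" by (simp add: mult_le_cancel_left1)
    hence "ln (M r) \<le> (2 * ln B + 2 * (d + 1)) * ln r"
      using log_bound[of r] r by (simp add: algebra_simps)
    moreover have "0 \<le> ln (M r)" using M_ge[of r] r by simp
    ultimately have "ln (M r) ^ 2 \<le> ((2 * ln B + 2 * (d + 1)) * ln r) ^ 2" by (intro power_mono)
    hence "K * ln (M r) ^ 2 \<le> K * ((2 * ln B + 2 * (d + 1)) * ln r) ^ 2" using K(1) by (rule mult_left_mono)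
    also have "\<dots> = K' * ln r ^ 2" by (simp add: K'_def power_mult_distrib)
    finally show ?thesis using est[OF ij, of r z] r z by linarith
  qed
  show ?thesis
  proof (rule Liouville_sublinear[where p = "\<lambda>z. h i z - h j z" and ?z0.0 = z0])
    show "line_holomorphic (\<lambda>z. h i z - h j z)" by (intro line_holomorphic_diff hol)
    fix \<epsilon> r0 :: real assume "\<epsilon> > 0"
    have "((\<lambda>r. K' * (ln r ^ 2 / r)) \<longlongrightarrow> K' * 0) at_top"
      by (intro tendsto_mult tendsto_const) real_asymp
    hence "eventually (\<lambda>r. K' * (ln r ^ 2 / r) < \<epsilon>) at_top"
      using \<open>\<epsilon> > 0\<close> by (intro order_tendstoD) auto
    then obtain r1 where r1: "\<And>r. r \<ge> r1 \<Longrightarrow> K' * (ln r ^ 2 / r) < \<epsilon>" by (auto simp: eventually_at_top_linorder)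
    \<comment> \<open>Borel's lemma is used in the variable \<open>s = ln r\<close>, where adding \<open>1 / m s\<close> to \<open>s\<close> multiplies \<open>r\<close>
      by \<open>exp (1 / ln (M r))\<close>.\<close>
    define m where "m s = ln (M (exp s))" for s
    have m1: "m s \<ge> 1" for s
    proof -
      have "M (exp s) \<ge> 3" using M_ge[of "exp s"] exp_gt_zero[of s] by linarith
      hence "exp 1 \<le> M (exp s)" using exp_le by linarith
      thus ?thesis unfolding m_def using \<open>M (exp s) \<ge> 3\<close> by (subst ln_ge_iff) auto
    qed
    have M_exp: "M (exp s) = exp (m s)" for s
    proof -
      have "M (exp s) > 0" using M_ge[of "exp s"] exp_gt_zero[of s] by linarith
      thus ?thesis by (simp add: m_def)
    qed
    have "\<exists>s\<ge>ln (max 3 (max r0 r1)). m (s + 1 / m s) \<le> 2 * m s"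
    proof (rule Borel_growth[OF _ m1])
      fix x y :: real assume "x \<le> y"
      hence "exp (m x) \<le> exp (m y)" unfolding M_exp[symmetric] by (intro M_mono) auto
      thus "m x \<le> m y" by simp
    qed
    then obtain s where s: "s \<ge> ln (max 3 (max r0 r1))" "m (s + 1 / m s) \<le> 2 * m s" by blast
    define r where "r = exp s"
    have "exp (ln (max 3 (max r0 r1))) \<le> r" unfolding r_def using s(1) by (simp only: exp_le_cancel_iff)
    moreover have "exp (ln (max 3 (max r0 r1))) = max 3 (max r0 r1)" by (intro exp_ln) auto
    ultimately have r: "r \<ge> 3" "r \<ge> r0" "r \<ge> r1" by auto
    have "M (r * exp (1 / ln (M r))) = exp (m (s + 1 / m s))"
      unfolding r_def M_exp[symmetric] by (simp add: exp_add m_def)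
    also have "\<dots> \<le> exp (2 * m s)" using s(2) by simp
    also have "\<dots> = M r ^ 2" unfolding r_def M_exp by (simp add: exp_double)
    finally have good: "M (r * exp (1 / ln (M r))) \<le> M r ^ 2" .
    have "K' * ln r ^ 2 \<le> \<epsilon> * r" using r1[OF r(3)] r(1) by (simp add: field_simps)
    hence "norm (h i z - h j z) \<le> \<epsilon> * r" if "z \<in> cball z0 r" for z
      using final[OF r(1) good that] by linarith
    with r(2) show "\<exists>r\<ge>r0. \<forall>z\<in>cball z0 r. norm (h i z - h j z) \<le> \<epsilon> * r" by blast
  qed
qed

section \<open>Entire functions, partial derivatives and polynomials\<close>

text \<open>
  Complex linearity is what turns the real derivative along a complex line into a complex derivative;
  it also expresses the derivative in any direction by those in the coordinate directions.
\<close>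

lemma entire_fun_directional:
  fixes u :: "complex ^ 'n \<Rightarrow> complex"
  assumes "entire_fun u"
  shows "\<exists>D. (\<forall>v t. ((\<lambda>t. u (z + t *s v)) has_field_derivative D (z + t *s v) v) (at t)) \<and>
             (\<forall>z v. D z v = (\<Sum>i\<in>UNIV. v $ i * D z (axis i 1)))"
proof -
  obtain D where D: "\<And>z. (u has_derivative D z) (at z)" "\<And>z c v. D z (c *s v) = c * D z v"
    using assms unfolding entire_fun_def by metis
  have lin: "linear (D z)" for z using D(1)[of z] by (rule has_derivative_linear)
  have "((\<lambda>t. u (z + t *s v)) has_field_derivative D (z + t *s v) v) (at t)" for v t
  proof -
    have bl: "bounded_linear (\<lambda>t::complex. t *s v)"
    proof
      show "\<exists>K. \<forall>x. norm (x *s v) \<le> norm x * K" by (intro exI[of _ "norm v"]) (simp add: norm_vector_smult)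
    qed (simp_all add: vector_sadd_rdistrib vec_eq_iff)
    have "((\<lambda>t. z + t *s v) has_derivative (\<lambda>t. t *s v)) (at t)"
      using has_derivative_add[OF has_derivative_const bounded_linear_imp_has_derivative[OF bl]] by simp
    from has_derivative_compose[OF this D(1)]
    have "((\<lambda>t. u (z + t *s v)) has_derivative (\<lambda>s. D (z + t *s v) (s *s v))) (at t)" by simp
    moreover have "(\<lambda>s. D (z + t *s v) (s *s v)) = (*) (D (z + t *s v) v)"
      by (simp add: fun_eq_iff D(2))
    ultimately show ?thesis by (simp add: has_field_derivative_def)
  qed
  moreover have "D z v = (\<Sum>i\<in>UNIV. v $ i * D z (axis i 1))" for z v
  proof -
    have "D z v = D z (\<Sum>i\<in>UNIV. v $ i *s axis i 1)" by (simp add: basis_expansion)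
    also have "\<dots> = (\<Sum>i\<in>UNIV. v $ i * D z (axis i 1))"
      by (simp only: linear_sum[OF lin] o_def D(2))
    finally show ?thesis .
  qed
  ultimately show ?thesis by blast
qed

lemma entire_fun_line_holomorphic:
  assumes "entire_fun u"
  shows "line_holomorphic u"
proof -
  have "continuous_on UNIV u"
    using assms unfolding entire_fun_def
    by (metis continuous_at_imp_continuous_on has_derivative_continuous)
  moreover have "(\<lambda>t. u (z + t *s v)) holomorphic_on UNIV" for z v
    using entire_fun_directional[OF assms, of z] holomorphic_on_open by blast
  ultimately show ?thesis by (simp add: line_holomorphic_def)
qed

lemma entire_fun_ddir_eq_sum:
  assumes "entire_fun u"
  shows "ddir v u z = (\<Sum>i\<in>UNIV. v $ i * ddir (axis i 1) u z)"
proof -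
  obtain D where D: "\<And>v t. ((\<lambda>t. u (z + t *s v)) has_field_derivative D (z + t *s v) v) (at t)"
    and sum: "\<And>z v. D z v = (\<Sum>i\<in>UNIV. v $ i * D z (axis i 1))"
    using entire_fun_directional[OF assms, of z] by blast
  have "ddir v u z = D z v" for v
    unfolding ddir_def using D[of v 0] by (intro DERIV_imp_deriv) simp
  thus ?thesis using sum[of z v] by simp
qed

lemma partial_deriv_eq_ddir:
  assumes "line_holomorphic f"
  shows "partial_deriv i f = ddir (axis i 1) f"
proof
  fix z :: "complex ^ 'a"
  have *: "(\<chi> k. if k = i then w else z $ k) = z + (w - z $ i) *s axis i 1" for w
    by (auto simp: vec_eq_iff axis_def)
  have "((\<lambda>t. f (z + t *s axis i 1)) has_field_derivative ddir (axis i 1) f z) (at 0)"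
    using has_field_derivative_ddir[OF assms, of z "axis i 1" 0 UNIV] by simp
  hence "((\<lambda>w. f (z + (w - z $ i) *s axis i 1)) has_field_derivative ddir (axis i 1) f z) (at (z $ i))"
    using DERIV_shift[of "\<lambda>w. f (z + (w - z $ i) *s axis i 1)" "ddir (axis i 1) f z" 0 "z $ i"] by simp
  thus "partial_deriv i f z = ddir (axis i 1) f z"
    unfolding partial_deriv_def * by (rule DERIV_imp_deriv)
qed

lemma ddir_sum:
  assumes "\<And>i. i \<in> I \<Longrightarrow> line_holomorphic (f i)"
  shows "ddir v (\<lambda>z. \<Sum>i\<in>I. c i * f i z) z = (\<Sum>i\<in>I. c i * ddir v (f i) z)"
proof -
  have "((\<lambda>t. \<Sum>i\<in>I. c i * f i (z + t *s v)) has_field_derivative (\<Sum>i\<in>I. c i * ddir v (f i) (z + 0 *s v))) (at 0)"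
    by (intro DERIV_sum DERIV_cmult has_field_derivative_ddir assms)
  thus ?thesis unfolding ddir_def[of v "\<lambda>z. \<Sum>i\<in>I. c i * f i z"] by (intro DERIV_imp_deriv) simp
qed

lemma polynomial_fun_continuous: "polynomial_fun g \<Longrightarrow> continuous_on UNIV g"
proof -
  assume "polynomial_fun g"
  then obtain S :: "('a \<Rightarrow> nat) set" and c where "g = (\<lambda>z. \<Sum>\<alpha>\<in>S. c \<alpha> * (\<Prod>i\<in>UNIV. (z $ i) ^ \<alpha> i))"
    unfolding polynomial_fun_def by blast
  thus ?thesis by (auto intro!: continuous_intros)
qed

lemma polynomial_fun_growth:
  fixes g :: "complex ^ 'n \<Rightarrow> complex"
  assumes "polynomial_fun g"
  shows "\<exists>A d. A \<ge> 0 \<and> (\<forall>z. norm (g z) \<le> A * (1 + norm z) ^ d)"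
proof -
  obtain S :: "('n \<Rightarrow> nat) set" and c where S: "finite S"
    and g: "g = (\<lambda>z. \<Sum>\<alpha>\<in>S. c \<alpha> * (\<Prod>i\<in>UNIV. (z $ i) ^ \<alpha> i))"
    using assms unfolding polynomial_fun_def by blast
  define deg where "deg \<alpha> = (\<Sum>i\<in>UNIV. \<alpha> i)" for \<alpha> :: "'n \<Rightarrow> nat"
  define d where "d = (\<Sum>\<alpha>\<in>S. deg \<alpha>)"
  have "norm (g z) \<le> (\<Sum>\<alpha>\<in>S. norm (c \<alpha>)) * (1 + norm z) ^ d" for z
  proof -
    have "norm (g z) \<le> (\<Sum>\<alpha>\<in>S. norm (c \<alpha> * (\<Prod>i\<in>UNIV. (z $ i) ^ \<alpha> i)))" unfolding g by (rule norm_sum)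
    also have "\<dots> \<le> (\<Sum>\<alpha>\<in>S. norm (c \<alpha>) * (1 + norm z) ^ d)"
    proof (rule sum_mono)
      fix \<alpha> assume \<alpha>: "\<alpha> \<in> S"
      have "norm (\<Prod>i\<in>UNIV. (z $ i) ^ \<alpha> i) = (\<Prod>i\<in>UNIV. norm (z $ i) ^ \<alpha> i)"
        by (simp add: prod_norm[symmetric] norm_power)
      also have "\<dots> \<le> (\<Prod>i\<in>UNIV. (1 + norm z) ^ \<alpha> i)"
      proof (intro prod_mono conjI power_mono)
        fix i show "norm (z $ i) \<le> 1 + norm z" using Finite_Cartesian_Product.norm_nth_le[of z i] by simp
      qed auto
      also have "\<dots> = (1 + norm z) ^ deg \<alpha>" by (simp add: deg_def power_sum)
      also have "\<dots> \<le> (1 + norm z) ^ d"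
        unfolding d_def using S \<alpha> by (intro power_increasing member_le_sum) auto
      finally show "norm (c \<alpha> * (\<Prod>i\<in>UNIV. (z $ i) ^ \<alpha> i)) \<le> norm (c \<alpha>) * (1 + norm z) ^ d"
        unfolding norm_mult by (intro mult_left_mono) auto
    qed
    finally show ?thesis by (simp add: sum_distrib_right)
  qed
  thus ?thesis by (intro exI[of _ "\<Sum>\<alpha>\<in>S. norm (c \<alpha>)"] exI[of _ d]) (auto intro: sum_nonneg)
qed

definition restrict_coords :: "'n set \<Rightarrow> complex ^ 'n \<Rightarrow> complex ^ 'n" where
  "restrict_coords B z = (\<chi> k. if k \<in> B then z $ k else 0)"

lemma restrict_coords_nth [simp]: "restrict_coords B z $ k = (if k \<in> B then z $ k else 0)"
  by (simp add: restrict_coords_def)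

lemma norm_restrict_coords_le: "norm (restrict_coords B z) \<le> norm z"
  by (intro norm_le_componentwise_cart) auto

section \<open>Blocks of chained indices\<close>

locale gradient_product_equation =
  fixes u g :: "complex ^ 'n \<Rightarrow> complex"
  assumes polynomial: "polynomial_fun g" and entire: "entire_fun u"
    and equation: "\<And>z. (\<Prod>i\<in>UNIV. partial_deriv i u z) = exp (g z)"
begin

definition pd :: "'n \<Rightarrow> (complex ^ 'n \<Rightarrow> complex) \<Rightarrow> complex ^ 'n \<Rightarrow> complex" where
  "pd i = ddir (axis i 1)"

lemma line_holomorphic_u: "line_holomorphic u" by (rule entire_fun_line_holomorphic[OF entire])
lemma line_holomorphic_pd: "line_holomorphic f \<Longrightarrow> line_holomorphic (pd i f)"
  unfolding pd_def by (rule ddir_line_holomorphic)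

lemma prod_pd: "(\<Prod>i\<in>UNIV. pd i u z) = exp (g z)"
  using equation[of z] by (simp add: partial_deriv_eq_ddir[OF line_holomorphic_u] pd_def)

lemma pd_nonzero: "pd i u z \<noteq> 0"
proof
  assume "pd i u z = 0"
  hence "(\<Prod>i\<in>UNIV. pd i u z) = 0" by (intro prod_zero) auto
  thus False unfolding prod_pd by simp
qed

lemma pd_commute: "pd i (pd j u) z = pd j (pd i u) z"
  unfolding pd_def by (rule ddir_commute[OF line_holomorphic_u])

lemma linked_iff: "linked u i j \<longleftrightarrow> (\<exists>z. pd j (pd i u) z \<noteq> 0)"
  by (simp add: linked_def partial_deriv2_def partial_deriv_eq_ddir line_holomorphic_u line_holomorphic_pd pd_def[symmetric])

text \<open>
  The chain rule for \<open>pd i u\<close>, obtained from the one for \<open>u\<close> by exchanging the two derivatives.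
\<close>

lemma ddir_pd: "ddir v (pd i u) z = (\<Sum>j\<in>UNIV. v $ j * pd j (pd i u) z)"
proof -
  have "ddir v (pd i u) z = pd i (ddir v u) z" unfolding pd_def by (rule ddir_commute[OF line_holomorphic_u])
  also have "ddir v u = (\<lambda>z. \<Sum>j\<in>UNIV. v $ j * pd j u z)"
    unfolding pd_def by (intro ext entire_fun_ddir_eq_sum[OF entire])
  also have "pd i \<dots> z = (\<Sum>j\<in>UNIV. v $ j * pd i (pd j u) z)"
    unfolding pd_def[of i] by (intro ddir_sum line_holomorphic_pd line_holomorphic_u)
  finally show ?thesis by (simp add: pd_commute)
qed

lemma linked_sym: "linked u i j \<Longrightarrow> linked u j i"
  by (auto simp: linked_iff pd_commute)

lemma chained_sym: "chained u i j \<Longrightarrow> chained u j i"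
  using sym_trancl[to_pred, of "linked u"] linked_sym unfolding chained_def by (blast dest: sympD intro: sympI)

text \<open>
  The class of \<open>i\<close>: the chain relation is made reflexive here, so that an index of \<open>J_set u\<close>
  forms a block of its own and all indices can be treated alike.
\<close>

definition block :: "'n \<Rightarrow> 'n set" where "block i = {j. j = i \<or> chained u i j}"

lemma in_block: "i \<in> block i" by (simp add: block_def)

lemma block_eq: "j \<in> block i \<Longrightarrow> block j = block i"
  unfolding block_def using chained_sym by (auto simp: chained_def dest: tranclp_trans)

lemma linked_in_block: "linked u i j \<Longrightarrow> j \<in> block i"
  by (auto simp: block_def chained_def)

lemma block_disjoint: "block i \<inter> block j \<noteq> {} \<Longrightarrow> block i = block j"
  using block_eq by blast

lemma sum_over_blocks: "(\<Sum>B\<in>range block. \<Sum>j\<in>B. f j) = (\<Sum>j\<in>UNIV. f j)" for f :: "'n \<Rightarrow> complex"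
proof -
  have "(\<Sum>j\<in>\<Union>(range block). f j) = (\<Sum>B\<in>range block. \<Sum>j\<in>B. f j)"
    using block_disjoint by (subst sum.Union_disjoint) auto
  moreover have "\<Union>(range block) = UNIV" using in_block by blast
  ultimately show ?thesis by simp
qed

lemma pd_pd_eq_0: "j \<notin> block i \<Longrightarrow> pd j (pd i u) z = 0"
  using linked_in_block linked_iff by blast

lemma logarithms_exist:
  "\<exists>h. \<forall>i. line_holomorphic (h i) \<and> (\<forall>z. pd i u z = exp (h i z))"
proof (intro choice allI)
  fix i
  show "\<exists>h. line_holomorphic h \<and> (\<forall>z. pd i u z = exp (h z))"
    by (rule line_holomorphic_logarithm[OF line_holomorphic_pd[OF line_holomorphic_u] pd_nonzero]) blast
qed

definition log_partial :: "'n \<Rightarrow> complex ^ 'n \<Rightarrow> complex" where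
  "log_partial = (SOME h. \<forall>i. line_holomorphic (h i) \<and> (\<forall>z. pd i u z = exp (h i z)))"

lemma line_holomorphic_log_partial: "line_holomorphic (log_partial i)" and pd_eq_exp: "pd i u z = exp (log_partial i z)"
  using someI_ex[OF logarithms_exist] unfolding log_partial_def by blast+

lemma ddir_log_partial: "ddir v (log_partial i) z = ddir v (pd i u) z / pd i u z"
  using ddir_exp[OF line_holomorphic_log_partial pd_eq_exp, of v i z] pd_nonzero[of i z] by (simp add: field_simps)

lemma pd_log_partial: "pd j (log_partial i) z = pd j (pd i u) z / pd i u z"
  unfolding pd_def[of j] by (rule ddir_log_partial)

lemma log_partial_eqI:
  assumes "\<And>z'. ddir (z - z0) (pd i u) z' = 0"
  shows "log_partial i z = log_partial i z0"
  using constant_if_ddir_zero[OF line_holomorphic_log_partial, of "z - z0" i z0] assms by (simp add: ddir_log_partial)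

text \<open>
  The logarithm with index \<open>i\<close> depends only on the variables of the block of \<open>i\<close>, because the derivative of
  \<open>pd i u\<close> in the direction of a variable outside the block vanishes.
\<close>

lemma log_partial_restrict: "log_partial i (restrict_coords (block i) z) = log_partial i z"
  by (rule log_partial_eqI[symmetric]) (auto simp: ddir_pd pd_pd_eq_0 intro!: sum.neutral)

lemma sum_log_partial: "\<exists>k::int. \<forall>z. (\<Sum>i\<in>UNIV. log_partial i z) = g z + 2 * of_int k * of_real pi * \<i>"
proof (rule continuous_logarithms_differ_by_constant)
  show "continuous_on UNIV (\<lambda>z. \<Sum>i\<in>UNIV. log_partial i z)"
    using line_holomorphic_log_partial by (auto intro!: continuous_intros simp: line_holomorphic_def)
  show "continuous_on UNIV g" by (rule polynomial_fun_continuous[OF polynomial])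
  fix z
  have "exp (\<Sum>i\<in>UNIV. log_partial i z) = (\<Prod>i\<in>UNIV. pd i u z)" by (simp add: exp_sum pd_eq_exp)
  thus "exp (\<Sum>i\<in>UNIV. log_partial i z) = exp (g z)"
    by (simp add: prod_pd)
qed

text \<open>
  Setting the variables outside the block to \<open>0\<close> in \<open>sum_log_partial\<close> leaves the summands of the block
  unchanged and makes the others constant. Hence the sum over one block still grows polynomially.
\<close>

lemma block_sum_log_partial: "\<exists>c. \<forall>z. (\<Sum>j\<in>block i. log_partial j z) = g (restrict_coords (block i) z) + c"
proof -
  obtain k :: int where k: "\<And>z. (\<Sum>i\<in>UNIV. log_partial i z) = g z + 2 * of_int k * of_real pi * \<i>"
    using sum_log_partial by blast
  have "(\<Sum>j\<in>block i. log_partial j z) = g (restrict_coords (block i) z) + (2 * of_int k * of_real pi * \<i> - (\<Sum>j\<in>-block i. log_partial j 0))" for z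
  proof -
    let ?z = "restrict_coords (block i) z"
    have "log_partial j ?z = log_partial j z" if "j \<in> block i" for j
      using log_partial_restrict[of j z] block_eq[OF that] by simp
    moreover have "log_partial j ?z = log_partial j 0" if "j \<notin> block i" for j
    proof -
      have "block i \<inter> block j = {}" using block_disjoint[of i j] in_block[of j] that by blast
      hence "restrict_coords (block j) ?z = 0" by (auto simp: vec_eq_iff)
      thus ?thesis using log_partial_restrict[of j ?z] by simp
    qed
    ultimately have "(\<Sum>j\<in>block i. log_partial j ?z) + (\<Sum>j\<in>-block i. log_partial j ?z) = (\<Sum>j\<in>block i. log_partial j z) + (\<Sum>j\<in>-block i. log_partial j 0)"
      by (intro arg_cong2[of _ _ _ _ "(+)"] sum.cong) auto
    moreover have "(\<Sum>j\<in>block i. log_partial j ?z) + (\<Sum>j\<in>-block i. log_partial j ?z) = (\<Sum>j\<in>UNIV. log_partial j ?z)"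
      using sum.subset_diff[of "block i" UNIV "\<lambda>j. log_partial j ?z"] by (simp add: Compl_eq_Diff_UNIV add.commute)
    ultimately have "(\<Sum>j\<in>block i. log_partial j z) + (\<Sum>j\<in>-block i. log_partial j 0) = g ?z + 2 * of_int k * of_real pi * \<i>"
      using k[of ?z] by (simp only:)
    thus ?thesis by (metis add_diff_cancel_right' add_diff_eq)
  qed
  thus ?thesis by blast
qed

text \<open>
  A bound for the differences along links adds up along a chain; the length of the chain is the
  constant.
\<close>

lemma block_chain_bound:
  assumes "j \<in> block i"
  shows "\<exists>C\<ge>0. \<forall>z \<Phi>. \<Phi> \<ge> 0 \<longrightarrow> (\<forall>a b. linked u a b \<longrightarrow> norm (log_partial a z - log_partial b z) \<le> \<Phi>) \<longrightarrow>
           norm (log_partial i z - log_partial j z) \<le> C * \<Phi>"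
proof -
  have "?thesis" if "tranclp (linked u) i j" using that
  proof (induction rule: tranclp_induct)
    case (base j)
    thus ?case by (intro exI[of _ 1]) auto
  next
    case (step j k)
    then obtain C where C: "C \<ge> 0" "\<And>z \<Phi>. \<Phi> \<ge> 0 \<Longrightarrow> (\<forall>a b. linked u a b \<longrightarrow> norm (log_partial a z - log_partial b z) \<le> \<Phi>) \<Longrightarrow>
           norm (log_partial i z - log_partial j z) \<le> C * \<Phi>" by blast
    show ?case
    proof (intro exI[of _ "C + 1"] conjI allI impI)
      fix z \<Phi> assume \<Phi>: "0 \<le> \<Phi>" "\<forall>a b. linked u a b \<longrightarrow> norm (log_partial a z - log_partial b z) \<le> \<Phi>"
      have "norm (log_partial i z - log_partial k z) \<le> norm (log_partial i z - log_partial j z) + norm (log_partial j z - log_partial k z)"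
        using norm_triangle_ineq[of "log_partial i z - log_partial j z" "log_partial j z - log_partial k z"] by simp
      also have "\<dots> \<le> C * \<Phi> + \<Phi>" using C(2)[OF \<Phi>] \<Phi>(2) step.hyps by (intro add_mono) auto
      finally show "norm (log_partial i z - log_partial k z) \<le> (C + 1) * \<Phi>" by (simp add: algebra_simps)
    qed (use C in simp)
  qed
  moreover have ?thesis if "j = i" using that by (intro exI[of _ 0]) auto
  ultimately show ?thesis using assms by (auto simp: block_def chained_def)
qed

text \<open>
  The number of indices of the block times \<open>log_partial i\<close> is the sum of the logarithms of the block,
  which grows polynomially, plus the sum of the differences from \<open>log_partial i\<close>.
\<close>

lemma log_partial_growth:
  "\<exists>A d. A \<ge> 0 \<and> (\<forall>i z \<Phi>. \<Phi> \<ge> 0 \<longrightarrow> (\<forall>a b. linked u a b \<longrightarrow> norm (log_partial a z - log_partial b z) \<le> \<Phi>) \<longrightarrow>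
      norm (log_partial i z) \<le> A * (1 + norm z) ^ d + A * \<Phi>)"
proof -
  obtain c where c: "\<And>i z. (\<Sum>j\<in>block i. log_partial j z) = g (restrict_coords (block i) z) + c i"
    using block_sum_log_partial by metis
  obtain A d where A: "A \<ge> 0" "\<And>z. norm (g z) \<le> A * (1 + norm z) ^ d"
    using polynomial_fun_growth[OF polynomial] by blast
  have "\<forall>i. \<forall>j\<in>block i. \<exists>C\<ge>0. \<forall>z \<Phi>. \<Phi> \<ge> 0 \<longrightarrow> (\<forall>a b. linked u a b \<longrightarrow> norm (log_partial a z - log_partial b z) \<le> \<Phi>) \<longrightarrow>
           norm (log_partial i z - log_partial j z) \<le> C * \<Phi>" using block_chain_bound by blast
  then obtain C where C: "\<And>i j. j \<in> block i \<Longrightarrow> C i j \<ge> 0"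
    "\<And>i j z \<Phi>. j \<in> block i \<Longrightarrow> \<Phi> \<ge> 0 \<Longrightarrow> \<forall>a b. linked u a b \<longrightarrow> norm (log_partial a z - log_partial b z) \<le> \<Phi> \<Longrightarrow>
           norm (log_partial i z - log_partial j z) \<le> C i j * \<Phi>" by metis
  define K where "K = (\<Sum>i\<in>UNIV. \<Sum>j\<in>block i. C i j)"
  have KC: "(\<Sum>j\<in>block i. C i j) \<le> K" for i
    unfolding K_def by (rule member_le_sum) (auto intro!: sum_nonneg C(1))
  have K: "K \<ge> 0" unfolding K_def by (intro sum_nonneg C(1))
  define q where "q = (\<Sum>i\<in>UNIV. norm (c i))"
  have q: "norm (c i) \<le> q" for i unfolding q_def by (rule member_le_sum) auto
  have q0: "q \<ge> 0" using norm_ge_zero q by (rule order_trans)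
  have "norm (log_partial i z) \<le> (A + q + K) * (1 + norm z) ^ d + (A + q + K) * \<Phi>"
    if \<Phi>: "\<Phi> \<ge> 0" "\<forall>a b. linked u a b \<longrightarrow> norm (log_partial a z - log_partial b z) \<le> \<Phi>" for i z \<Phi>
  proof -
    have one: "1 \<le> (1 + norm z) ^ d" by (intro one_le_power) simp
    have "norm (g (restrict_coords (block i) z)) \<le> A * (1 + norm (restrict_coords (block i) z)) ^ d" by (rule A(2))
    also have "\<dots> \<le> A * (1 + norm z) ^ d"
      using A(1) norm_restrict_coords_le[of "block i" z] by (intro mult_left_mono power_mono) auto
    finally have g: "norm (g (restrict_coords (block i) z)) \<le> A * (1 + norm z) ^ d" .
    have "card (block i) \<ge> 1" using in_block[of i] by (simp add: Suc_le_eq card_gt_0_iff) blast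
    hence "1 * norm (log_partial i z) \<le> real (card (block i)) * norm (log_partial i z)" by (intro mult_right_mono) auto
    also have "\<dots> = norm (of_nat (card (block i)) * log_partial i z)" by (simp add: norm_mult)
    also have "of_nat (card (block i)) * log_partial i z = (\<Sum>j\<in>block i. log_partial j z) + (\<Sum>j\<in>block i. log_partial i z - log_partial j z)"
      by (simp add: sum_subtractf)
    also have "norm \<dots> \<le> norm (g (restrict_coords (block i) z) + c i) + (\<Sum>j\<in>block i. norm (log_partial i z - log_partial j z))"
      unfolding c by (rule order_trans[OF norm_triangle_ineq add_left_mono[OF norm_sum]])
    also have "\<dots> \<le> (A * (1 + norm z) ^ d + q) + (\<Sum>j\<in>block i. C i j * \<Phi>)"
      using g q[of i] norm_triangle_ineq[of "g (restrict_coords (block i) z)" "c i"]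
      by (intro add_mono sum_mono C(2) \<Phi>) auto
    also have "(\<Sum>j\<in>block i. C i j * \<Phi>) \<le> K * \<Phi>"
      unfolding sum_distrib_right[symmetric] using KC \<Phi>(1) by (rule mult_right_mono)
    also have "A * (1 + norm z) ^ d + q + K * \<Phi> \<le> (A + q + K) * (1 + norm z) ^ d + (A + q + K) * \<Phi>"
    proof -
      have "q * 1 \<le> q * (1 + norm z) ^ d" using one q0 by (rule mult_left_mono)
      moreover have "0 \<le> K * (1 + norm z) ^ d" "0 \<le> (A + q) * \<Phi>" using K A q0 \<Phi>(1) by auto
      ultimately show ?thesis by (simp add: algebra_simps)
    qed
    finally show ?thesis by simp
  qed
  thus ?thesis using A(1) q0 K by (intro exI[of _ "A + q + K"] exI[of _ d]) auto
qed

text \<open>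
  For linked \<open>i\<close> and \<open>j\<close> the symmetry of the mixed second derivative reads
  \<open>exp (h i) h i,j = exp (h j) h j,i\<close> with \<open>h = log_partial\<close> and derivatives behind the comma. This is the
  quotient representation of \<open>exp (h i - h j)\<close> that the growth argument needs.
\<close>

lemma linked_log_diff_constant:
  assumes "linked u i j"
  shows "log_partial i z - log_partial j z = log_partial i z' - log_partial j z'"
proof -
  obtain A d where A: "A \<ge> 0"
    "\<And>i z \<Phi>. \<Phi> \<ge> 0 \<Longrightarrow> (\<forall>a b. linked u a b \<longrightarrow> norm (log_partial a z - log_partial b z) \<le> \<Phi>) \<Longrightarrow>
      norm (log_partial i z) \<le> A * (1 + norm z) ^ d + A * \<Phi>" using log_partial_growth by blast
  show ?thesis
  proof (rule linked_logarithms_differ_by_constants[where E = "{(i, j). linked u i j}" and h = log_partial])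
    show "exp (log_partial i z - log_partial j z) * ddir (axis j 1) (log_partial i) z = ddir (axis i 1) (log_partial j) z" for i j z
      using pd_commute[of i j z] pd_nonzero[of i z] pd_nonzero[of j z]
      by (simp add: pd_def[symmetric] pd_log_partial exp_diff pd_eq_exp[symmetric])
    show "\<exists>z. ddir (axis j 1) (log_partial i) z \<noteq> 0" if "(i, j) \<in> {(i, j). linked u i j}" for i j
      using that pd_nonzero by (simp add: pd_def[symmetric] pd_log_partial linked_iff)
    show "norm (log_partial i z) \<le> A * (1 + norm z) ^ d + A * \<Phi>"
      if "\<And>a b. (a, b) \<in> {(i, j). linked u i j} \<Longrightarrow> norm (log_partial a z - log_partial b z) \<le> \<Phi>" "\<Phi> \<ge> 0" for i z \<Phi>
      using that by (intro A(2)) auto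
  qed (use line_holomorphic_log_partial A assms in auto)
qed

lemma block_log_diff_constant:
  assumes "j \<in> block i"
  shows "log_partial i z - log_partial j z = log_partial i z' - log_partial j z'"
proof -
  have "log_partial i z - log_partial j z = log_partial i z' - log_partial j z'" if "tranclp (linked u) i j" using that
  proof (induction rule: tranclp_induct)
    case (step j k)
    have split: "log_partial i w - log_partial k w = (log_partial i w - log_partial j w) + (log_partial j w - log_partial k w)" for w by simp
    show ?case unfolding split step.IH linked_log_diff_constant[OF step.hyps(2), of z z'] ..
  qed (rule linked_log_diff_constant)
  thus ?thesis using assms by (auto simp: block_def chained_def)
qed

section \<open>The solution on a block as a function of one linear form\<close>

definition block_exponent :: "'n set \<Rightarrow> complex ^ 'n \<Rightarrow> complex" where
  "block_exponent B z = (\<Sum>j\<in>B. log_partial j z)"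

text \<open>
  Within a block the logarithms differ by constants, hence each of them is their average plus a
  constant, whose exponential is the coefficient of \<open>z $ j\<close> in the linear form of the block.
\<close>

definition coefficient :: "'n \<Rightarrow> complex" where
  "coefficient j = exp (log_partial j 0 - block_exponent (block j) 0 / of_nat (card (block j)))"

lemma coefficient_nonzero [simp]: "coefficient j \<noteq> 0"
  by (simp add: coefficient_def)

lemma card_block_pos: "card (block i) > 0"
  using in_block[of i] by (auto simp: card_gt_0_iff)

lemma pd_eq_coefficient_exp:
  "pd j u z = coefficient j * exp (block_exponent (block j) z / of_nat (card (block j)))"
proof -
  let ?m = "of_nat (card (block j)) :: complex"
  have m: "?m \<noteq> 0" using card_block_pos[of j] unfolding of_nat_eq_0_iff by linarith
  have mean: "?m * log_partial j w = (\<Sum>k\<in>block j. log_partial j w - log_partial k w) + block_exponent (block j) w" for w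
    by (simp add: block_exponent_def sum_subtractf)
  have "(\<Sum>k\<in>block j. log_partial j z - log_partial k z) = (\<Sum>k\<in>block j. log_partial j 0 - log_partial k 0)"
    by (intro sum.cong refl block_log_diff_constant)
  with mean[of z] mean[of 0]
  have "?m * log_partial j z = ?m * log_partial j 0 - block_exponent (block j) 0 + block_exponent (block j) z" by simp
  hence "log_partial j z = log_partial j 0 - block_exponent (block j) 0 / ?m + block_exponent (block j) z / ?m"
    using m by (simp add: field_simps)
  thus ?thesis by (simp add: pd_eq_exp coefficient_def exp_add[symmetric])
qed

definition linear_form :: "'n set \<Rightarrow> complex ^ 'n \<Rightarrow> complex" where
  "linear_form B z = (\<Sum>j\<in>B. coefficient j * z $ j)"

text \<open>
  A vector on which the linear form of the block takes the value 1. It turns functions of the linear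
  form into functions of one variable.
\<close>

definition base_vector :: "'n set \<Rightarrow> complex ^ 'n" where
  "base_vector B = (let r = SOME i. i \<in> B in axis r (1 / coefficient r))"

lemma base_vector_block:
  obtains r where "r \<in> block i" "base_vector (block i) = axis r (1 / coefficient r)"
  using someI[of "\<lambda>j. j \<in> block i", OF in_block] by (auto simp: base_vector_def Let_def)

lemma linear_form_base_vector: "linear_form (block i) (base_vector (block i)) = 1"
proof -
  obtain r where r: "r \<in> block i" "base_vector (block i) = axis r (1 / coefficient r)"
    by (rule base_vector_block)
  have "linear_form (block i) (base_vector (block i)) = (\<Sum>j\<in>block i. if j = r then 1 else 0)"
    unfolding linear_form_def r(2) by (intro sum.cong) (auto simp: axis_def)
  thus ?thesis using r(1) by simp
qed

text \<open>
  All the gradients of the block are parallel to the coefficient vector, so the Hessian of \<open>u\<close> on the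
  block is a multiple of the matrix of products of two coefficients. It annihilates the kernel of the
  linear form, along which the logarithms are therefore constant.
\<close>

lemma block_exponent_eq:
  assumes "B \<in> range block"
  shows "block_exponent B z = block_exponent B (linear_form B z *s base_vector B)"
  unfolding block_exponent_def
proof (rule sum.cong[OF refl])
  fix j assume j: "j \<in> B"
  have B: "B = block j" using assms j block_eq by auto
  define v where "v = z - linear_form B z *s base_vector B"
  have v0: "linear_form B v = 0"
  proof -
    have "linear_form B v = linear_form B z - linear_form B z * linear_form B (base_vector B)"
      unfolding linear_form_def[of B v] linear_form_def[of B "base_vector B"] v_def
      by (simp add: linear_form_def sum_subtractf algebra_simps sum_distrib_left)
    thus ?thesis using linear_form_base_vector[of j] B by simp
  qed
  show "log_partial j z = log_partial j (linear_form B z *s base_vector B)"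
  proof (rule log_partial_eqI)
    fix z'
    \<comment> \<open>The row of \<open>j\<close> in the Hessian, expressed by its diagonal entry.\<close>
    have cross: "pd k (pd j u) z' = coefficient k * (pd j (pd j u) z' / coefficient j)" if "k \<in> B" for k
    proof -
      have "block k = block j" using that B block_eq by simp
      hence "pd k u = (\<lambda>z. \<Sum>i\<in>{j}. (coefficient k / coefficient i) * pd i u z)"
        using pd_eq_coefficient_exp[of k] pd_eq_coefficient_exp[of j] by auto
      hence "pd j (pd k u) z' = (\<Sum>i\<in>{j}. (coefficient k / coefficient i) * pd j (pd i u) z')"
        unfolding pd_def[of j] using line_holomorphic_pd[OF line_holomorphic_u] by (simp only: ddir_sum)
      thus ?thesis by (simp add: pd_commute[of k j])
    qed
    have "ddir v (pd j u) z' = (\<Sum>k\<in>B. v $ k * pd k (pd j u) z')"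
      unfolding ddir_pd using pd_pd_eq_0[of _ j] B by (intro sum.mono_neutral_right) auto
    also have "\<dots> = linear_form B v * (pd j (pd j u) z' / coefficient j)"
      unfolding linear_form_def sum_distrib_right by (intro sum.cong) (auto simp: cross)
    finally show "ddir (z - linear_form B z *s base_vector B) (pd j u) z' = 0"
      unfolding v_def[symmetric] using v0 by simp
  qed
qed

definition profile_exponent :: "'n set \<Rightarrow> complex \<Rightarrow> complex" where
  "profile_exponent B w = block_exponent B (w *s base_vector B)"

text \<open>
  The restriction of \<open>u\<close> to the line spanned by the base vector. The constants distribute the value
  \<open>u 0\<close> evenly over the blocks, so that the profiles add up to \<open>u\<close> exactly.
\<close>

definition profile :: "'n set \<Rightarrow> complex \<Rightarrow> complex" where
  "profile B w = u (w *s base_vector B) - u 0 + u 0 / of_nat (card (range block))"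

lemma profile_exponent_holomorphic: "profile_exponent B holomorphic_on UNIV"
proof -
  have "(\<lambda>w. log_partial j (0 + w *s base_vector B)) holomorphic_on UNIV" for j
    using line_holomorphic_log_partial by (simp only: line_holomorphic_def)
  thus ?thesis unfolding profile_exponent_def block_exponent_def by (auto intro!: holomorphic_intros)
qed

lemma profile_derivative:
  assumes "B \<in> range block"
  shows "(profile B has_field_derivative exp (profile_exponent B w / of_nat (card B))) (at w)"
proof -
  obtain i where i: "B = block i" using assms by blast
  obtain r where r: "r \<in> B" "base_vector B = axis r (1 / coefficient r)"
    using base_vector_block[of i] unfolding i by blast
  have B: "B = block r" using block_eq[of r i] r(1) i by simp
  have "((\<lambda>w. u (0 + w *s base_vector B)) has_field_derivative ddir (base_vector B) u (0 + w *s base_vector B)) (at w)"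
    by (rule has_field_derivative_ddir[OF line_holomorphic_u])
  moreover have "ddir (base_vector B) u (0 + w *s base_vector B) = exp (profile_exponent B w / of_nat (card B))"
  proof -
    have "ddir (base_vector B) u (w *s base_vector B) = (\<Sum>j\<in>UNIV. base_vector B $ j * pd j u (w *s base_vector B))"
      unfolding pd_def by (rule entire_fun_ddir_eq_sum[OF entire])
    also have "\<dots> = (\<Sum>j\<in>UNIV. if j = r then 1 / coefficient r * pd r u (w *s base_vector B) else 0)"
      by (intro sum.cong) (auto simp: r(2) axis_def)
    also have "\<dots> = 1 / coefficient r * pd r u (w *s base_vector B)" by simp
    also have "\<dots> = exp (profile_exponent B w / of_nat (card B))"
      by (simp add: pd_eq_coefficient_exp profile_exponent_def B[symmetric])
    finally show ?thesis by simp
  qed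
  ultimately show ?thesis unfolding profile_def[abs_def] by (auto intro!: derivative_eq_intros)
qed

text \<open>
  Both sides have the same derivative along the line from \<open>0\<close> to \<open>z\<close>, by the chain rule and by
  grouping the partial derivatives into blocks.
\<close>

lemma u_representation: "u z = (\<Sum>B\<in>range block. profile B (linear_form B z))"
proof -
  define \<phi> where "\<phi> t = u (0 + t *s z) - (\<Sum>B\<in>range block. profile B (t * linear_form B z))" for t
  have "(\<phi> has_field_derivative 0) (at t within UNIV)" for t
  proof -
    have lin: "linear_form B (t *s z) = t * linear_form B z" for B
      by (simp add: linear_form_def sum_distrib_left mult_ac)
    have part: "pd j u (t *s z) = coefficient j * exp (profile_exponent B (t * linear_form B z) / of_nat (card B))"
      if "B \<in> range block" "j \<in> B" for B j
    proof -
      have "B = block j" using that block_eq by auto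
      thus ?thesis
        using pd_eq_coefficient_exp[of j "t *s z"] block_exponent_eq[OF that(1), of "t *s z"]
        by (simp add: profile_exponent_def lin)
    qed
    have "ddir z u (0 + t *s z) = (\<Sum>j\<in>UNIV. z $ j * pd j u (t *s z))"
      unfolding pd_def using entire_fun_ddir_eq_sum[OF entire, of z "t *s z"] by simp
    also have "\<dots> = (\<Sum>B\<in>range block. \<Sum>j\<in>B. z $ j * pd j u (t *s z))" by (simp add: sum_over_blocks)
    also have "\<dots> = (\<Sum>B\<in>range block. exp (profile_exponent B (t * linear_form B z) / of_nat (card B)) * linear_form B z)"
    proof (rule sum.cong[OF refl])
      fix B assume B: "B \<in> range block"
      let ?e = "exp (profile_exponent B (t * linear_form B z) / of_nat (card B))"
      have "(\<Sum>j\<in>B. z $ j * pd j u (t *s z)) = (\<Sum>j\<in>B. ?e * (coefficient j * z $ j))"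
        using part[OF B] by (intro sum.cong refl) (simp only: mult_ac)
      also have "\<dots> = ?e * linear_form B z" by (simp only: linear_form_def sum_distrib_left)
      finally show "(\<Sum>j\<in>B. z $ j * pd j u (t *s z)) = ?e * linear_form B z" .
    qed
    finally have d: "ddir z u (0 + t *s z) = \<dots>" .
    have "((\<lambda>t. profile B (t * linear_form B z)) has_field_derivative
             exp (profile_exponent B (t * linear_form B z) / of_nat (card B)) * linear_form B z) (at t)"
      if "B \<in> range block" for B
      by (rule DERIV_chain2[OF profile_derivative[OF that]]) (auto intro!: derivative_eq_intros)
    hence "(\<phi> has_field_derivative ddir z u (0 + t *s z) -
             (\<Sum>B\<in>range block. exp (profile_exponent B (t * linear_form B z) / of_nat (card B)) * linear_form B z)) (at t)"
      unfolding \<phi>_def by (intro DERIV_diff DERIV_sum has_field_derivative_ddir[OF line_holomorphic_u])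
    thus ?thesis by (simp only: d diff_self)
  qed
  then obtain c where "\<And>t. \<phi> t = c"
    using has_field_derivative_zero_constant[of UNIV \<phi>] by auto
  hence "\<phi> 1 = \<phi> 0" by simp
  moreover have "(\<Sum>B\<in>range block. profile B 0) = u 0"
    by (simp add: profile_def card_gt_0_iff)
  ultimately show ?thesis by (simp add: \<phi>_def)
qed

lemma g_representation:
  "\<exists>k0::int. \<forall>z. g z = (\<Sum>B\<in>range block. profile_exponent B (linear_form B z)) + 2 * of_int k0 * of_real pi * \<i>"
proof -
  obtain k :: int where k: "\<And>z. (\<Sum>i\<in>UNIV. log_partial i z) = g z + 2 * of_int k * of_real pi * \<i>"
    using sum_log_partial by blast
  have "(\<Sum>B\<in>range block. profile_exponent B (linear_form B z)) = (\<Sum>i\<in>UNIV. log_partial i z)" for z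
    unfolding sum_over_blocks[symmetric] using block_exponent_eq[symmetric]
    by (intro sum.cong) (auto simp: profile_exponent_def block_exponent_def[symmetric])
  hence "g z = (\<Sum>B\<in>range block. profile_exponent B (linear_form B z)) + 2 * of_int (- k) * of_real pi * \<i>" for z
    using k[of z] by simp
  thus ?thesis by blast
qed

section \<open>Separation of the isolated indices\<close>

lemma J_set_iff: "i \<in> J_set u \<longleftrightarrow> (\<forall>j. j \<noteq> i \<longrightarrow> \<not> linked u i j)"
  by (auto simp: J_set_def linked_def)

lemma block_J: "i \<in> J_set u \<Longrightarrow> block i = {i}"
proof -
  assume i: "i \<in> J_set u"
  have "j = i" if "tranclp (linked u) i j" for j
    using that by (induction rule: tranclp_induct) (use i J_set_iff in blast)+
  thus "block i = {i}" by (auto simp: block_def chained_def)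
qed

text \<open>
  The average of a single logarithm is that logarithm. For isolated indices the linear form is
  therefore the coordinate itself.
\<close>

lemma coefficient_J: "i \<in> J_set u \<Longrightarrow> coefficient i = 1"
  by (simp add: coefficient_def block_J block_exponent_def)

lemma linear_form_J: "i \<in> J_set u \<Longrightarrow> linear_form {i} z = z $ i"
  by (simp add: linear_form_def coefficient_J)

lemma block_not_J:
  assumes "i \<notin> J_set u"
  shows "block i \<subseteq> UNIV - J_set u" "card (block i) \<ge> 2" "chained u i i"
proof -
  obtain j where j: "j \<noteq> i" "linked u i j" using assms J_set_iff by blast
  show "block i \<subseteq> UNIV - J_set u"
  proof
    fix k assume k: "k \<in> block i"
    show "k \<in> UNIV - J_set u" using block_eq[OF k] block_J[of k] in_block[of i] k assms by auto
  qed
  have "card {i, j} \<le> card (block i)"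
    using in_block linked_in_block[OF j(2)] by (intro card_mono) auto
  thus "card (block i) \<ge> 2" using j(1) by simp
  show "chained u i i" unfolding chained_def
    using j(2) linked_sym[OF j(2)] by (meson tranclp.r_into_trancl tranclp.trancl_into_trancl)
qed

lemma chained_iff_block: "i \<notin> J_set u \<Longrightarrow> chained u i j \<longleftrightarrow> j \<in> block i"
  using block_not_J(3)[of i] by (auto simp: block_def)

lemma chain_partition_exists:
  obtains t P \<theta> k where "chain_partition u (UNIV - J_set u) t P \<theta> k"
    "bij_betw P {1..t} (block ` (UNIV - J_set u))"
    "\<And>l. l \<in> {1..t} \<Longrightarrow> \<theta> l = card (P l)"
    "\<And>l. l \<in> {1..t} \<Longrightarrow> bij_betw (k l) {1..\<theta> l} (P l)"
proof -
  let ?\<B> = "block ` (UNIV - J_set u)"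
  obtain P where P: "bij_betw P {1..card ?\<B>} ?\<B>"
    using ex_bij_betw_nat_finite_1[of ?\<B>] by auto
  define t where "t = card ?\<B>"
  define \<theta> where "\<theta> l = card (P l)" for l
  have "\<exists>k. bij_betw k {1..\<theta> l} (P l)" for l
    unfolding \<theta>_def by (rule ex_bij_betw_nat_finite_1) simp
  then obtain k where k: "\<And>l. bij_betw (k l) {1..\<theta> l} (P l)" by metis
  have P_img: "P ` {1..t} = ?\<B>" and P_inj: "inj_on P {1..t}"
    using P by (auto simp: bij_betw_def t_def)
  have P_block: "P l = block i" "i \<notin> J_set u" if l: "l \<in> {1..t}" and i: "i \<in> P l" for l i
  proof -
    have "P l \<in> ?\<B>" using l P_img by blast
    then obtain a where a: "P l = block a" "a \<notin> J_set u" by blast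
    show "P l = block i" using a i block_eq by simp
    show "i \<notin> J_set u" using block_not_J(1)[OF a(2)] i a(1) by blast
  qed
  have "chain_partition u (UNIV - J_set u) t P \<theta> k"
    unfolding chain_partition_def
  proof (intro conjI ballI)
    have "\<Union>(?\<B>) = UNIV - J_set u" using block_not_J(1) in_block by blast
    thus "UNIV - J_set u = (\<Union>l\<in>{1..t}. P l)" unfolding P_img[symmetric] by simp
    show "disjoint_family_on P {1..t}"
      unfolding disjoint_family_on_def
    proof (intro ballI impI)
      fix l m assume lm: "l \<in> {1..t}" "m \<in> {1..t}" "l \<noteq> m"
      hence "P l \<noteq> P m" using P_inj by (auto dest: inj_onD)
      thus "P l \<inter> P m = {}" using P_block(1)[OF lm(1)] P_block(1)[OF lm(2)] by blast
    qed
    fix l assume l: "l \<in> {1..t}"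
    show "P l = k l ` {1..\<theta> l}" using k[of l] by (simp add: bij_betw_def)
    show "card (P l) = \<theta> l" by (simp add: \<theta>_def)
    have "P l \<in> ?\<B>" using l P_img by blast
    thus "\<theta> l \<ge> 2" unfolding \<theta>_def using block_not_J(2) by auto
  next
    fix \<mu> \<nu> i j assume "\<mu> \<in> {1..t}" "\<nu> \<in> {1..t}" and i: "i \<in> P \<mu>" and j: "j \<in> P \<nu>"
    note mem = this
    have i_block: "P \<mu> = block i" "i \<notin> J_set u" using P_block[OF mem(1) i] .
    have j_block: "P \<nu> = block j" using P_block[OF mem(2) j] by blast
    show "\<mu> = \<nu> \<longrightarrow> chained u i j" using chained_iff_block[OF i_block(2)] i_block(1) j by auto
    show "\<mu> \<noteq> \<nu> \<longrightarrow> \<not> chained u i j"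
    proof (intro impI notI)
      assume "\<mu> \<noteq> \<nu>" "chained u i j"
      hence "P \<nu> = P \<mu>" using chained_iff_block[OF i_block(2)] i_block(1) j_block block_eq by simp
      thus False using P_inj mem \<open>\<mu> \<noteq> \<nu>\<close> by (auto dest: inj_onD)
    qed
  qed
  thus ?thesis using P k by (intro that[of t P \<theta> k]) (auto simp: t_def \<theta>_def)
qed

lemma sum_split_blocks:
  fixes X :: "'n set \<Rightarrow> complex"
  assumes "bij_betw P {1..t::nat} (block ` (UNIV - J_set u))"
  shows "(\<Sum>B\<in>range block. X B) = (\<Sum>i\<in>J_set u. X {i}) + (\<Sum>l=1..t. X (P l))"
proof -
  have img: "block ` J_set u = (\<lambda>i. {i}) ` J_set u" using block_J by auto
  have "range block = block ` J_set u \<union> block ` (UNIV - J_set u)" by blast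
  moreover have "block ` J_set u \<inter> block ` (UNIV - J_set u) = {}"
    using in_block block_not_J(1) by fastforce
  ultimately have "(\<Sum>B\<in>range block. X B) = (\<Sum>B\<in>block ` J_set u. X B) + (\<Sum>B\<in>block ` (UNIV - J_set u). X B)"
    by (simp add: sum.union_disjoint)
  also have "(\<Sum>B\<in>block ` J_set u. X B) = (\<Sum>i\<in>J_set u. X {i})"
    unfolding img by (subst sum.reindex) (auto simp: inj_on_def)
  also have "(\<Sum>B\<in>block ` (UNIV - J_set u). X B) = (\<Sum>l=1..t. X (P l))"
    using sum.reindex_bij_betw[OF assms, of X] by simp
  finally show ?thesis .
qed

lemma singleton_in_blocks: "i \<in> J_set u \<Longrightarrow> {i} \<in> range block"
  using block_J by blast

lemma profile_antiderivative:
  assumes "B \<in> range block"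
  shows "entire_antiderivative (profile B) (\<lambda>w. exp (profile_exponent B w / of_nat (card B)))"
  unfolding entire_antiderivative_def using profile_derivative[OF assms] holomorphic_on_open by blast

text \<open>
  The form of \<open>u\<close> and \<open>g\<close> for arbitrary \<open>J_set u\<close>; the three cases of the theorem are instances,
  in which one of the two sums may be empty.
\<close>

theorem solution_structure:
  "\<exists>t P \<theta> k gs f A (k0 :: int).
     chain_partition u (UNIV - J_set u) t P \<theta> k \<and>
     (\<forall>l\<in>{1..t}. gs l holomorphic_on UNIV) \<and>
     (\<forall>l\<in>{1..t}. entire_antiderivative (f l) (\<lambda>w. exp (gs l w / of_nat (\<theta> l)))) \<and>
     (\<forall>i\<in>J_set u. profile_exponent {i} holomorphic_on UNIV \<and> entire_antiderivative (profile {i}) (\<lambda>w. exp (profile_exponent {i} w))) \<and>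
     (\<forall>z. g z = (\<Sum>i\<in>J_set u. profile_exponent {i} (z $ i)) + (\<Sum>l=1..t. gs l (\<Sum>j=1..\<theta> l. A l j * z $ k l j))
                + 2 * of_int k0 * of_real pi * \<i>) \<and>
     (\<forall>z. u z = (\<Sum>i\<in>J_set u. profile {i} (z $ i)) + (\<Sum>l=1..t. f l (\<Sum>j=1..\<theta> l. A l j * z $ k l j)))"
proof -
  obtain t P \<theta> k where cp: "chain_partition u (UNIV - J_set u) t P \<theta> k"
    and P: "bij_betw P {1..t} (block ` (UNIV - J_set u))"
    and \<theta>: "\<And>l. l \<in> {1..t} \<Longrightarrow> \<theta> l = card (P l)"
    and k: "\<And>l. l \<in> {1..t} \<Longrightarrow> bij_betw (k l) {1..\<theta> l} (P l)"
    using chain_partition_exists by metis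
  obtain k0 :: int where k0: "\<And>z. g z = (\<Sum>B\<in>range block. profile_exponent B (linear_form B z)) + 2 * of_int k0 * of_real pi * \<i>"
    using g_representation by blast
  have P_range: "P l \<in> range block" if "l \<in> {1..t}" for l
    using bij_betwE[OF P] that by blast
  have form: "linear_form (P l) z = (\<Sum>j=1..\<theta> l. coefficient (k l j) * z $ k l j)" if "l \<in> {1..t}" for l z
    unfolding linear_form_def
    by (rule sum.reindex_bij_betw[OF k[OF that], of "\<lambda>j. coefficient j * z $ j", symmetric])
  have split: "(\<Sum>B\<in>range block. X B (linear_form B z)) = (\<Sum>i\<in>J_set u. X {i} (z $ i)) +
                 (\<Sum>l=1..t. X (P l) (\<Sum>j=1..\<theta> l. coefficient (k l j) * z $ k l j))"
    for X :: "'n set \<Rightarrow> complex \<Rightarrow> complex" and z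
    unfolding sum_split_blocks[OF P] by (intro arg_cong2[of _ _ _ _ "(+)"] sum.cong) (auto simp: linear_form_J form)
  show ?thesis
  proof (intro exI conjI)
    show "chain_partition u (UNIV - J_set u) t P \<theta> k" by (rule cp)
    show "\<forall>l\<in>{1..t}. profile_exponent (P l) holomorphic_on UNIV" using profile_exponent_holomorphic by blast
    show "\<forall>l\<in>{1..t}. entire_antiderivative (profile (P l)) (\<lambda>w. exp (profile_exponent (P l) w / of_nat (\<theta> l)))"
      using profile_antiderivative[OF P_range] \<theta> by simp
    show "\<forall>i\<in>J_set u. profile_exponent {i} holomorphic_on UNIV \<and> entire_antiderivative (profile {i}) (\<lambda>w. exp (profile_exponent {i} w))"
      using profile_antiderivative[OF singleton_in_blocks] profile_exponent_holomorphic by simp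
    show "\<forall>z. g z = (\<Sum>i\<in>J_set u. profile_exponent {i} (z $ i)) + (\<Sum>l=1..t. profile_exponent (P l) (\<Sum>j=1..\<theta> l. coefficient (k l j) * z $ k l j))
                + 2 * of_int k0 * of_real pi * \<i>"
      using k0 split[of profile_exponent] by simp
    show "\<forall>z. u z = (\<Sum>i\<in>J_set u. profile {i} (z $ i)) + (\<Sum>l=1..t. profile (P l) (\<Sum>j=1..\<theta> l. coefficient (k l j) * z $ k l j))"
      using u_representation split[of profile] by simp
  qed
qed

end

lemma chain_partition_empty: "chain_partition u {} t P \<theta> k \<Longrightarrow> t = 0"
proof (rule ccontr)
  assume cp: "chain_partition u {} t P \<theta> k" and "t \<noteq> 0"
  hence "1 \<in> {1..t}" by simp
  with cp have "P 1 = {}" "card (P 1) \<ge> 2" unfolding chain_partition_def by (blast, metis)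
  thus False by simp
qed

text \<open>
  If every index is isolated, the partition of the empty complement has no blocks; if none is, the sum
  over the isolated indices is empty.
\<close>

theorem theorem2:
  fixes u g :: "complex ^ 'n \<Rightarrow> complex"
  assumes g_poly: "polynomial_fun g"
    and u_entire: "entire_fun u"
    and pde: "\<And>z. (\<Prod>i\<in>UNIV. partial_deriv i u z) = exp (g z)"
  shows
    "(card (J_set u) = CARD('n) \<longrightarrow>
       (\<exists>(gs :: 'n \<Rightarrow> complex \<Rightarrow> complex) (F :: 'n \<Rightarrow> complex \<Rightarrow> complex) (k0 :: int).
          (\<forall>j. gs j holomorphic_on UNIV) \<and>
          (\<forall>j. entire_antiderivative (F j) (\<lambda>w. exp (gs j w))) \<and>
          (\<forall>z. g z = (\<Sum>j\<in>UNIV. gs j (z $ j)) + 2 * of_int k0 * of_real pi * \<i>) \<and>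
          (\<forall>z. u z = (\<Sum>j\<in>UNIV. F j (z $ j)))))
     \<and>
     (card (J_set u) = 0 \<longrightarrow>
       (\<exists>(t :: nat) (P :: nat \<Rightarrow> 'n set) (\<theta> :: nat \<Rightarrow> nat) (k :: nat \<Rightarrow> nat \<Rightarrow> 'n).
          chain_partition u UNIV t P \<theta> k \<and>
          (\<exists>(gs :: nat \<Rightarrow> complex \<Rightarrow> complex) (f :: nat \<Rightarrow> complex \<Rightarrow> complex)
              (A :: nat \<Rightarrow> nat \<Rightarrow> complex) (k0 :: int).
             (\<forall>l\<in>{1..t}. gs l holomorphic_on UNIV) \<and>
             (\<forall>l\<in>{1..t}. entire_antiderivative (f l) (\<lambda>w. exp (gs l w / of_nat (\<theta> l)))) \<and>
             (\<forall>z. g z = (\<Sum>l=1..t. gs l (\<Sum>j=1..\<theta> l. A l j * z $ k l j))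
                        + 2 * of_int k0 * of_real pi * \<i>) \<and>
             (\<forall>z. u z = (\<Sum>l=1..t. f l (\<Sum>j=1..\<theta> l. A l j * z $ k l j))))))
     \<and>
     (0 < card (J_set u) \<and> card (J_set u) < CARD('n) \<longrightarrow>
       (\<forall>(\<nu> :: nat) (\<tau> :: nat \<Rightarrow> 'n).
          \<nu> = card (J_set u) \<and> J_set u = \<tau> ` {1..\<nu>} \<longrightarrow>
          (\<exists>(t :: nat) (P :: nat \<Rightarrow> 'n set) (\<theta> :: nat \<Rightarrow> nat) (k :: nat \<Rightarrow> nat \<Rightarrow> 'n).
             chain_partition u (UNIV - J_set u) t P \<theta> k \<and>
             (\<exists>(gs :: nat \<Rightarrow> complex \<Rightarrow> complex) (F :: nat \<Rightarrow> complex \<Rightarrow> complex)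
                 (h :: nat \<Rightarrow> complex \<Rightarrow> complex) (f :: nat \<Rightarrow> complex \<Rightarrow> complex)
                 (A :: nat \<Rightarrow> nat \<Rightarrow> complex) (k0 :: int).
                (\<forall>i\<in>{1..\<nu>}. gs i holomorphic_on UNIV) \<and>
                (\<forall>i\<in>{1..\<nu>}. entire_antiderivative (F i) (\<lambda>w. exp (gs i w))) \<and>
                (\<forall>l\<in>{1..t}. h l holomorphic_on UNIV) \<and>
                (\<forall>l\<in>{1..t}. entire_antiderivative (f l) (\<lambda>w. exp (h l w / of_nat (\<theta> l)))) \<and>
                (\<forall>z. g z = (\<Sum>i=1..\<nu>. gs i (z $ \<tau> i))
                           + (\<Sum>l=1..t. h l (\<Sum>j=1..\<theta> l. A l j * z $ k l j))
                           + 2 * of_int k0 * of_real pi * \<i>) \<and>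
                (\<forall>z. u z = (\<Sum>i=1..\<nu>. F i (z $ \<tau> i))
                           + (\<Sum>l=1..t. f l (\<Sum>j=1..\<theta> l. A l j * z $ k l j)))))))"
proof -
  interpret gradient_product_equation u g
    using g_poly u_entire pde by unfold_locales
  obtain t P \<theta> k gs f A and k0 :: int where
    cp: "chain_partition u (UNIV - J_set u) t P \<theta> k"
    and gs: "\<forall>l\<in>{1..t}. gs l holomorphic_on UNIV"
    and f: "\<forall>l\<in>{1..t}. entire_antiderivative (f l) (\<lambda>w. exp (gs l w / of_nat (\<theta> l)))"
    and J: "\<And>i. i \<in> J_set u \<Longrightarrow> profile_exponent {i} holomorphic_on UNIV"
      "\<And>i. i \<in> J_set u \<Longrightarrow> entire_antiderivative (profile {i}) (\<lambda>w. exp (profile_exponent {i} w))"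
    and g_eq: "\<And>z. g z = (\<Sum>i\<in>J_set u. profile_exponent {i} (z $ i)) + (\<Sum>l=1..t. gs l (\<Sum>j=1..\<theta> l. A l j * z $ k l j))
                + 2 * of_int k0 * of_real pi * \<i>"
    and u_eq: "\<And>z. u z = (\<Sum>i\<in>J_set u. profile {i} (z $ i)) + (\<Sum>l=1..t. f l (\<Sum>j=1..\<theta> l. A l j * z $ k l j))"
    using solution_structure by blast
  show ?thesis
  proof (intro conjI impI allI; (elim conjE)?)
    assume "card (J_set u) = CARD('n)"
    hence all: "J_set u = UNIV" by (simp add: card_subset_eq)
    with cp have "t = 0" using chain_partition_empty by simp
    have g_eq': "\<forall>z. g z = (\<Sum>i\<in>UNIV. profile_exponent {i} (z $ i)) + 2 * of_int k0 * of_real pi * \<i>"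
      and u_eq': "\<forall>z. u z = (\<Sum>i\<in>UNIV. profile {i} (z $ i))"
      using g_eq u_eq all \<open>t = 0\<close> by simp_all
    show "\<exists>(gs :: 'n \<Rightarrow> complex \<Rightarrow> complex) (F :: 'n \<Rightarrow> complex \<Rightarrow> complex) (k0 :: int).
          (\<forall>j. gs j holomorphic_on UNIV) \<and>
          (\<forall>j. entire_antiderivative (F j) (\<lambda>w. exp (gs j w))) \<and>
          (\<forall>z. g z = (\<Sum>j\<in>UNIV. gs j (z $ j)) + 2 * of_int k0 * of_real pi * \<i>) \<and>
          (\<forall>z. u z = (\<Sum>j\<in>UNIV. F j (z $ j)))"
      by (rule exI[of _ "\<lambda>i. profile_exponent {i}"], rule exI[of _ "\<lambda>i. profile {i}"], rule exI[of _ k0],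
          intro conjI allI J g_eq' u_eq') (simp_all add: all)
  next
    assume "card (J_set u) = 0"
    hence none: "J_set u = {}" by simp
    have g_eq': "g z = (\<Sum>l=1..t. gs l (\<Sum>j=1..\<theta> l. A l j * z $ k l j)) + 2 * of_int k0 * of_real pi * \<i>"
      and u_eq': "u z = (\<Sum>l=1..t. f l (\<Sum>j=1..\<theta> l. A l j * z $ k l j))" for z
      using g_eq[of z] u_eq[of z] none by simp_all
    show "\<exists>(t :: nat) (P :: nat \<Rightarrow> 'n set) (\<theta> :: nat \<Rightarrow> nat) (k :: nat \<Rightarrow> nat \<Rightarrow> 'n).
          chain_partition u UNIV t P \<theta> k \<and>
          (\<exists>(gs :: nat \<Rightarrow> complex \<Rightarrow> complex) (f :: nat \<Rightarrow> complex \<Rightarrow> complex)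
              (A :: nat \<Rightarrow> nat \<Rightarrow> complex) (k0 :: int).
             (\<forall>l\<in>{1..t}. gs l holomorphic_on UNIV) \<and>
             (\<forall>l\<in>{1..t}. entire_antiderivative (f l) (\<lambda>w. exp (gs l w / of_nat (\<theta> l)))) \<and>
             (\<forall>z. g z = (\<Sum>l=1..t. gs l (\<Sum>j=1..\<theta> l. A l j * z $ k l j))
                        + 2 * of_int k0 * of_real pi * \<i>) \<and>
             (\<forall>z. u z = (\<Sum>l=1..t. f l (\<Sum>j=1..\<theta> l. A l j * z $ k l j))))"
      by (rule exI[of _ t], rule exI[of _ P], rule exI[of _ \<theta>], rule exI[of _ k],
          rule conjI, rule cp[unfolded none Diff_empty],
          rule exI[of _ gs], rule exI[of _ f], rule exI[of _ A], rule exI[of _ k0],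
          intro conjI gs f allI g_eq' u_eq')
  next
    fix \<nu> and \<tau> :: "nat \<Rightarrow> 'n"
    assume \<nu>: "\<nu> = card (J_set u)" and \<tau>: "J_set u = \<tau> ` {1..\<nu>}"
    have "inj_on \<tau> {1..\<nu>}" using \<nu> \<tau> by (intro eq_card_imp_inj_on) auto
    hence reindex: "(\<Sum>i\<in>J_set u. X i) = (\<Sum>i=1..\<nu>. X (\<tau> i))" for X :: "'n \<Rightarrow> complex"
      unfolding \<tau> by (simp add: sum.reindex)
    have in_J: "\<tau> i \<in> J_set u" if "i \<in> {1..\<nu>}" for i using that \<tau> by blast
    show "\<exists>(t :: nat) (P :: nat \<Rightarrow> 'n set) (\<theta> :: nat \<Rightarrow> nat) (k :: nat \<Rightarrow> nat \<Rightarrow> 'n).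
             chain_partition u (UNIV - J_set u) t P \<theta> k \<and>
             (\<exists>(gs :: nat \<Rightarrow> complex \<Rightarrow> complex) (F :: nat \<Rightarrow> complex \<Rightarrow> complex)
                 (log_partial :: nat \<Rightarrow> complex \<Rightarrow> complex) (f :: nat \<Rightarrow> complex \<Rightarrow> complex)
                 (A :: nat \<Rightarrow> nat \<Rightarrow> complex) (k0 :: int).
                (\<forall>i\<in>{1..\<nu>}. gs i holomorphic_on UNIV) \<and>
                (\<forall>i\<in>{1..\<nu>}. entire_antiderivative (F i) (\<lambda>w. exp (gs i w))) \<and>
                (\<forall>l\<in>{1..t}. log_partial l holomorphic_on UNIV) \<and>
                (\<forall>l\<in>{1..t}. entire_antiderivative (f l) (\<lambda>w. exp (log_partial l w / of_nat (\<theta> l)))) \<and>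
                (\<forall>z. g z = (\<Sum>i=1..\<nu>. gs i (z $ \<tau> i))
                           + (\<Sum>l=1..t. log_partial l (\<Sum>j=1..\<theta> l. A l j * z $ k l j))
                           + 2 * of_int k0 * of_real pi * \<i>) \<and>
                (\<forall>z. u z = (\<Sum>i=1..\<nu>. F i (z $ \<tau> i))
                           + (\<Sum>l=1..t. f l (\<Sum>j=1..\<theta> l. A l j * z $ k l j))))"
      by (rule exI[of _ t], rule exI[of _ P], rule exI[of _ \<theta>], rule exI[of _ k],
          rule conjI, rule cp, rule exI[of _ "\<lambda>i. profile_exponent {\<tau> i}"], rule exI[of _ "\<lambda>i. profile {\<tau> i}"],
          rule exI[of _ gs], rule exI[of _ f], rule exI[of _ A], rule exI[of _ k0],
          intro conjI gs f allI ballI J in_J g_eq[unfolded reindex] u_eq[unfolded reindex])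
  qed
qed

end
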